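(* Let $H_1,H_2$ be Hilbert spaces, $A_j\in\mathcal{B}(H_j)$ positive for $j=1,2$, and $X\in\mathcal{B}(H_2,H_1)$, and suppose $T=\begin{bmatrix}A_1 & X\\ X^* & A_2\end{bmatrix}$ is a positive operator on $H_1\oplus H_2$. If $A_j\in\mathcal{AM}(H_j)$ for $j=1,2$, $\sigma_{ess}(A_1)=\sigma_{ess}(A_2)$, and $X$ has finite rank, then $T\in\mathcal{AM}(H_1\oplus H_2)$.
   Context: Throughout, Hilbert spaces are complex, separable and infinite dimensional; $\mathcal{B}(H_1,H_2)$ denotes bounded linear operators. For $S\in\mathcal{B}(H_1,H_2)$ the minimum modulus is $m(S)=\inf\{\|Sx\|:\|x\|=1\}$; $S$ is minimum attaining if $\|Sx\|=m(S)$ for some unit vector $x$. $S$ is absolutely minimum attaining, written $S\in\mathcal{AM}(H_1,H_2)$ (and $\mathcal{AM}(H)=\mathcal{AM}(H,H)$), if for every nonzero closed subspace $M\subseteq H_1$ the restriction $S|_M$ is minimum attaining. $\sigma_{ess}(R)$ for $R\in\mathcal{B}(H)$ is the set of $\lambda\in\mathbb{C}$ with $R-\lambda I$ not Fredholm. *)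

theory Defs
  imports "HOL-Analysis.Analysis"
begin

class complex_vector = real_vector +
  fixes scaleC :: "complex \<Rightarrow> 'a \<Rightarrow> 'a" (infixr \<open>*\<^sub>C\<close> 75)
  assumes scaleC_add_right: "scaleC a (x + y) = scaleC a x + scaleC a y"
    and scaleC_add_left: "scaleC (a + b) x = scaleC a x + scaleC b x"
    and scaleC_scaleC: "scaleC a (scaleC b x) = scaleC (a * b) x"
    and scaleC_one: "scaleC 1 x = x"
    and scaleR_scaleC: "scaleR r x = scaleC (complex_of_real r) x"

class complex_inner = complex_vector + real_normed_vector +
  fixes cinner :: "'a \<Rightarrow> 'a \<Rightarrow> complex"
  assumes cinner_commute: "cinner x y = cnj (cinner y x)"
    and cinner_add_left: "cinner (x + y) z = cinner x z + cinner y z"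
    and cinner_scaleC_left: "cinner (scaleC r x) y = cnj r * cinner x y"
    and cinner_real: "Im (cinner x x) = 0"
    and cinner_ge_zero: "0 \<le> Re (cinner x x)"
    and cinner_eq_zero_iff: "cinner x x = 0 \<longleftrightarrow> x = 0"
    and norm_eq_sqrt_cinner: "norm x = sqrt (Re (cinner x x))"

class chilbert_space = complex_inner + complete_space

instantiation prod :: (complex_vector, complex_vector) complex_vector
begin
definition scaleC_prod_def: "scaleC a x = (scaleC a (fst x), scaleC a (snd x))"
instance
  by standard (auto simp: scaleC_prod_def scaleC_add_right scaleC_add_left
      scaleC_scaleC scaleC_one scaleR_scaleC scaleR_prod_def)
end

lemma Re_cinner_norm: "Re (cinner x x) = (norm (x::'a::complex_inner))\<^sup>2"
  using norm_eq_sqrt_cinner[of x] cinner_ge_zero[of x] by simp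

instantiation prod :: (complex_inner, complex_inner) complex_inner
begin
definition cinner_prod_def:
  "cinner x y = cinner (fst x) (fst y) + cinner (snd x) (snd y)"
instance
proof
  fix x y z :: "'a \<times> 'b" and r :: complex
  show "cinner x y = cnj (cinner y x)"
    by (simp add: cinner_prod_def cinner_commute[of "fst x"] cinner_commute[of "snd x"])
  show "cinner (x + y) z = cinner x z + cinner y z"
    by (simp add: cinner_prod_def cinner_add_left)
  show "cinner (r *\<^sub>C x) y = cnj r * cinner x y"
    by (simp add: cinner_prod_def scaleC_prod_def cinner_scaleC_left distrib_left)
  show "Im (cinner x x) = 0"
    by (simp add: cinner_prod_def cinner_real)
  show "0 \<le> Re (cinner x x)"
    by (simp add: cinner_prod_def cinner_ge_zero add_nonneg_nonneg)
  show "cinner x x = 0 \<longleftrightarrow> x = 0"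
  proof
    assume h: "cinner x x = 0"
    have "Re (cinner (fst x) (fst x)) + Re (cinner (snd x) (snd x)) = 0"
      using arg_cong[OF h, of Re] by (simp add: cinner_prod_def)
    then have "Re (cinner (fst x) (fst x)) = 0" "Re (cinner (snd x) (snd x)) = 0"
      using cinner_ge_zero[of "fst x"] cinner_ge_zero[of "snd x"] by linarith+
    then have "fst x = 0" "snd x = 0"
      by (simp_all add: Re_cinner_norm)
    then show "x = 0" by (simp add: prod_eq_iff)
  qed (simp add: cinner_prod_def cinner_eq_zero_iff[THEN iffD2])
  show "norm x = sqrt (Re (cinner x x))"
    by (simp add: norm_prod_def cinner_prod_def Re_cinner_norm)
qed
end

instance prod :: (chilbert_space, chilbert_space) chilbert_space ..

definition separable_metric :: "'a::metric_space itself \<Rightarrow> bool" where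
  "separable_metric _ \<longleftrightarrow> (\<exists>D::'a set. countable D \<and> closure D = UNIV)"

definition cfinite_dim :: "'a::complex_vector set \<Rightarrow> bool" where
  "cfinite_dim S \<longleftrightarrow> (\<exists>F. finite F \<and> (\<forall>x\<in>S. \<exists>c. x = (\<Sum>f\<in>F. c f *\<^sub>C f)))"

definition infinite_dimensional :: "'a::complex_vector itself \<Rightarrow> bool" where
  "infinite_dimensional _ \<longleftrightarrow> \<not> cfinite_dim (UNIV :: 'a set)"

definition bounded_clinear :: "('a::complex_inner \<Rightarrow> 'b::complex_inner) \<Rightarrow> bool" where
  "bounded_clinear f \<longleftrightarrow>
     (\<forall>x y. f (x + y) = f x + f y) \<and> (\<forall>c x. f (c *\<^sub>C x) = c *\<^sub>C f x) \<and>
     (\<exists>K. \<forall>x. norm (f x) \<le> norm x * K)"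

definition cadjoint :: "('a::complex_inner \<Rightarrow> 'b::complex_inner) \<Rightarrow> 'b \<Rightarrow> 'a" where
  "cadjoint S = (\<lambda>y. THE z. \<forall>x. cinner z x = cinner y (S x))"

definition positive_op :: "('a::complex_inner \<Rightarrow> 'a) \<Rightarrow> bool" where
  "positive_op A \<longleftrightarrow> bounded_clinear A \<and>
     (\<forall>x. Im (cinner x (A x)) = 0 \<and> 0 \<le> Re (cinner x (A x)))"

definition finite_rank :: "('a::complex_inner \<Rightarrow> 'b::complex_inner) \<Rightarrow> bool" where
  "finite_rank S \<longleftrightarrow> cfinite_dim (range S)"

definition closed_csubspace :: "'a::complex_inner set \<Rightarrow> bool" where
  "closed_csubspace M \<longleftrightarrow> closed M \<and> 0 \<in> M \<and>
     (\<forall>x\<in>M. \<forall>y\<in>M. x + y \<in> M) \<and> (\<forall>c. \<forall>x\<in>M. c *\<^sub>C x \<in> M)"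

definition min_modulus_on :: "('a::complex_inner \<Rightarrow> 'b::complex_inner) \<Rightarrow> 'a set \<Rightarrow> real" where
  "min_modulus_on S M = Inf ((\<lambda>x. norm (S x)) ` {x\<in>M. norm x = 1})"

definition min_attaining_on :: "('a::complex_inner \<Rightarrow> 'b::complex_inner) \<Rightarrow> 'a set \<Rightarrow> bool" where
  "min_attaining_on S M \<longleftrightarrow> (\<exists>x\<in>M. norm x = 1 \<and> norm (S x) = min_modulus_on S M)"

definition abs_min_attaining :: "('a::complex_inner \<Rightarrow> 'b::complex_inner) \<Rightarrow> bool" where
  "abs_min_attaining S \<longleftrightarrow> bounded_clinear S \<and>
     (\<forall>M. closed_csubspace M \<and> M \<noteq> {0} \<longrightarrow> min_attaining_on S M)"

definition fredholm :: "('a::complex_inner \<Rightarrow> 'b::complex_inner) \<Rightarrow> bool" where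
  "fredholm S \<longleftrightarrow> bounded_clinear S \<and> cfinite_dim {x. S x = 0} \<and>
     (\<exists>F. finite F \<and> (\<forall>y. \<exists>c x. y = S x + (\<Sum>f\<in>F. c f *\<^sub>C f)))"

definition ess_spectrum :: "('a::complex_inner \<Rightarrow> 'a) \<Rightarrow> complex set" where
  "ess_spectrum R = {z. \<not> fredholm (\<lambda>x. R x - z *\<^sub>C x)}"

definition block_op ::
  "('a::complex_inner \<Rightarrow> 'a) \<Rightarrow> ('b::complex_inner \<Rightarrow> 'a) \<Rightarrow> ('b \<Rightarrow> 'b) \<Rightarrow> 'a \<times> 'b \<Rightarrow> 'a \<times> 'b" where
  "block_op A1 X A2 = (\<lambda>(x, y). (A1 x + X y, cadjoint X x + A2 y))"

end

theory Submission
  imports Defs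
begin

text \<open>For a finite set \<open>F\<close> let \<open>corth F\<close> be its orthogonal complement, and call \<open>\<beta>\<close> the limit modulus
  of \<open>T\<close> if \<open>\<parallel>T x\<parallel> \<ge> (\<beta> - \<epsilon>) \<parallel>x\<parallel>\<close> on some \<open>corth F\<close> for every \<open>\<epsilon> > 0\<close>, while \<open>\<parallel>T x\<parallel> \<le> \<beta> \<parallel>x\<parallel>\<close> on some
  \<open>corth F\<close>. An operator with a limit modulus is absolutely minimum attaining: if the infimum \<open>m\<close> on
  a subspace is at least \<open>\<beta>\<close>, any unit vector of it in \<open>corth F\<close> attains it; otherwise
  \<open>\<parallel>T x\<parallel>\<^sup>2 - m\<^sup>2 \<parallel>x\<parallel>\<^sup>2\<close> is coercive up to finite dimension and minimizing sequences have convergent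
  subsequences. Conversely, a positive absolutely minimum attaining \<open>A\<close> has a limit modulus \<open>\<beta>\<close>,
  and then \<open>A - \<beta>\<close> is small on subspaces of finite codimension, so that the essential spectrum is
  \<open>{\<beta>}\<close>. Hence \<open>A1\<close> and \<open>A2\<close> share their limit modulus, and the block operator, which agrees with
  \<open>A1 \<oplus> A2\<close> on a subspace of finite codimension, inherits it.\<close>

section \<open>Complex inner products and their norms\<close>

instance chilbert_space \<subseteq> banach ..

lemma cinner_scaleC_right: "cinner x (c *\<^sub>C y) = c * cinner (x::'a::complex_inner) y"
  by (metis cinner_commute cinner_scaleC_left complex_cnj_cnj complex_cnj_mult)

lemma norm_scaleC: "norm (c *\<^sub>C x) = cmod c * norm (x::'a::complex_inner)"
proof -
  have "cinner (c *\<^sub>C x) (c *\<^sub>C x) = (c * cnj c) * cinner x x"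
    by (simp add: cinner_scaleC_left cinner_scaleC_right)
  also have "c * cnj c = complex_of_real ((cmod c)\<^sup>2)" by (simp only: complex_norm_square)
  finally have "(norm (c *\<^sub>C x))\<^sup>2 = (cmod c * norm x)\<^sup>2"
    by (simp add: Re_cinner_norm[symmetric] power_mult_distrib)
  then show ?thesis by simp
qed

lemma norm_add_sq:
  "(norm (x + y))\<^sup>2 = (norm x)\<^sup>2 + (norm y)\<^sup>2 + 2 * Re (cinner x (y::'a::complex_inner))"
proof -
  have "cinner (x + y) (x + y) = cinner x x + cinner y y + (cinner x y + cnj (cinner x y))"
    by (metis (no_types, lifting) add.assoc add.commute cinner_add_left cinner_commute complex_cnj_add)
  from arg_cong[OF this, of Re] show ?thesis by (simp add: Re_cinner_norm)
qed

text \<open>Squaring the triangle inequality, which the class \<open>real_normed_vector\<close>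
  provides, leaves exactly this bound on the cross term.\<close>

lemma Re_cinner_le: "Re (cinner x y) \<le> norm x * norm (y::'a::complex_inner)"
proof -
  have "(norm (x + y))\<^sup>2 \<le> (norm x + norm y)\<^sup>2"
    by (intro power_mono norm_triangle_ineq) auto
  then show ?thesis by (simp add: norm_add_sq power2_sum)
qed

text \<open>Rotating \<open>x\<close> by the phase \<open>sgn ?z\<close> of the inner product makes
  the product real and equal to its modulus, so the bound on real parts applies.\<close>

lemma Cauchy_Schwarz_cinner: "cmod (cinner x y) \<le> norm x * norm (y::'a::complex_inner)"
proof (cases "cinner x y = 0")
  case False
  let ?z = "cinner x y"
  have "cmod ?z = Re (cnj (sgn ?z) * ?z)"
    using False cmod_power2[of ?z]
    by (simp add: sgn_div_norm add_divide_distrib[symmetric] power2_eq_square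
        nonzero_eq_divide_eq divide_inverse_commute[symmetric])
  also have "\<dots> = Re (cinner (sgn ?z *\<^sub>C x) y)" by (simp add: cinner_scaleC_left)
  also have "\<dots> \<le> norm (sgn ?z *\<^sub>C x) * norm y" by (rule Re_cinner_le)
  finally show ?thesis using False by (simp add: norm_scaleC norm_sgn)
qed simp

interpretation scaleC: bounded_bilinear "scaleC :: complex \<Rightarrow> 'a \<Rightarrow> 'a::complex_inner"
proof
  show "\<exists>K. \<forall>a b. norm (a *\<^sub>C b) \<le> norm a * norm (b::'a) * K"
    by (rule exI[of _ 1]) (simp add: norm_scaleC)
qed (simp_all add: scaleC_add_left scaleC_add_right scaleR_scaleC scaleC_scaleC
    scaleR_conv_of_real mult.commute)

interpretation cinner: bounded_bilinear "cinner :: 'a \<Rightarrow> 'a::complex_inner \<Rightarrow> complex"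
proof
  show "\<exists>K. \<forall>a b. norm (cinner a b) \<le> norm a * norm (b::'a) * K"
    by (rule exI[of _ 1]) (simp add: Cauchy_Schwarz_cinner)
  show "cinner a (b + b') = cinner a b + cinner a b'" for a b b' :: 'a
    by (metis cinner_add_left cinner_commute complex_cnj_add)
qed (simp_all add: cinner_add_left scaleR_scaleC cinner_scaleC_left cinner_scaleC_right
    scaleR_conv_of_real)

lemma cinner_eq_0_commute: "cinner x y = 0 \<longleftrightarrow> cinner y (x::'a::complex_inner) = 0"
  by (metis cinner_commute complex_cnj_zero_iff)

lemma cinner_self: "cinner x x = complex_of_real ((norm (x::'a::complex_inner))\<^sup>2)"
  by (simp add: complex_eq_iff Re_cinner_norm cinner_real)

lemma norm_pythagoras:
  "cinner x y = 0 \<Longrightarrow> (norm (x + y))\<^sup>2 = (norm x)\<^sup>2 + (norm (y::'a::complex_inner))\<^sup>2"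
  by (simp add: norm_add_sq)

lemma bounded_clinear_imp_bounded_linear: "bounded_clinear f \<Longrightarrow> bounded_linear f"
  by (metis (no_types, lifting) bounded_clinear_def bounded_linear_intro scaleR_scaleC)

lemma bounded_clinear_scaleC: "bounded_clinear f \<Longrightarrow> f (c *\<^sub>C x) = c *\<^sub>C f x"
  by (simp add: bounded_clinear_def)

section \<open>Subspaces and orthogonal complements of finite sets\<close>

definition csubspace :: "'a::complex_inner set \<Rightarrow> bool" where
  "csubspace W \<longleftrightarrow> 0 \<in> W \<and> (\<forall>x\<in>W. \<forall>y\<in>W. x + y \<in> W) \<and> (\<forall>c. \<forall>x\<in>W. c *\<^sub>C x \<in> W)"

lemma closed_csubspace_iff: "closed_csubspace M \<longleftrightarrow> closed M \<and> csubspace M"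
  by (simp add: closed_csubspace_def csubspace_def)

lemma csubspace_scaleC: "csubspace W \<Longrightarrow> x \<in> W \<Longrightarrow> c *\<^sub>C x \<in> W"
  by (simp add: csubspace_def)

lemma csubspace_add: "csubspace W \<Longrightarrow> x \<in> W \<Longrightarrow> y \<in> W \<Longrightarrow> x + y \<in> W"
  by (simp add: csubspace_def)

lemma csubspace_diff: "csubspace W \<Longrightarrow> x \<in> W \<Longrightarrow> y \<in> W \<Longrightarrow> x - y \<in> W"
proof -
  assume W: "csubspace W" "x \<in> W" "y \<in> W"
  then have "x + (-1) *\<^sub>C y \<in> W" by (simp add: csubspace_def)
  moreover have "x + (-1) *\<^sub>C y = x - y" by (simp add: scaleC.minus_left scaleC_one)
  ultimately show "x - y \<in> W" by simp
qed

lemma csubspace_normalize: "csubspace W \<Longrightarrow> x \<in> W \<Longrightarrow> sgn x \<in> W"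
  by (simp add: sgn_div_norm scaleR_scaleC csubspace_scaleC)

text \<open>For finite \<open>F\<close> these serve as the subspaces of finite codimension on which
  asymptotic estimates are stated; enlarging \<open>F\<close> intersects them.\<close>

definition corth :: "'a::complex_inner set \<Rightarrow> 'a set" where
  "corth F = {x. \<forall>f\<in>F. cinner f x = 0}"

lemma csubspace_corth: "csubspace (corth F)"
  by (auto simp: corth_def csubspace_def cinner.add_right cinner_scaleC_right cinner.zero_right)

lemma csubspace_Int: "csubspace V \<Longrightarrow> csubspace W \<Longrightarrow> csubspace (V \<inter> W)"
  by (auto simp: csubspace_def)

lemma closed_corth: "closed (corth F)"
proof -
  have "corth F = (\<Inter>f\<in>F. {x. cinner f x = 0})" by (auto simp: corth_def)
  moreover have "closed {x. cinner f x = 0}" for f :: 'a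
    by (intro closed_Collect_eq continuous_intros
        bounded_linear.continuous_on[OF cinner.bounded_linear_right])
  ultimately show ?thesis by auto
qed

lemma corth_insert: "corth (insert f F) = corth {f} \<inter> corth F"
  by (auto simp: corth_def)

lemma corth_Un: "corth (F \<union> G) = corth F \<inter> corth G"
  by (auto simp: corth_def)

lemma cinner_corth_sum: "x \<in> corth F \<Longrightarrow> cinner x (\<Sum>f\<in>F. c f *\<^sub>C f) = 0"
  by (subst cinner_eq_0_commute)
    (simp add: corth_def cinner.sum_left cinner_scaleC_left)

text \<open>The case \<open>q = 0\<close> is covered because division by zero yields 0, so the
  Gram-Schmidt step below also works for dependent vectors.\<close>

lemma cinner_orthogonal_residual:
  "cinner q (p - (cinner q p / cinner q q) *\<^sub>C (q::'a::complex_inner)) = 0"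
  by (cases "q = 0")
    (simp_all add: cinner.diff_right cinner_scaleC_right cinner.zero_left cinner_eq_zero_iff)

text \<open>Gram-Schmidt in terms of coefficients. The induction hypothesis strips from both
  \<open>f\<close> and \<open>x\<close> their parts along \<open>F\<close>; removing from the
  remainder \<open>?p\<close> its component along \<open>?q\<close> makes it orthogonal to
  \<open>f\<close> as well.\<close>

lemma corth_decomposition:
  fixes x :: "'a::complex_inner"
  assumes "finite F"
  shows "\<exists>c. x - (\<Sum>f\<in>F. c f *\<^sub>C f) \<in> corth F"
  using assms
proof (induction F arbitrary: x)
  case empty
  show ?case by (simp add: corth_def)
next
  case (insert f F)
  obtain c where c: "f - (\<Sum>g\<in>F. c g *\<^sub>C g) \<in> corth F" (is "?q \<in> _") using insert.IH by blast
  obtain d where d: "x - (\<Sum>g\<in>F. d g *\<^sub>C g) \<in> corth F" (is "?p \<in> _") using insert.IH by blast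
  define a where "a = cinner ?q ?p / cinner ?q ?q"
  let ?y = "?p - a *\<^sub>C ?q"
  have yF: "?y \<in> corth F"
    using c d by (simp add: corth_def cinner.diff_right cinner_scaleC_right)
  have "cinner ?q ?y = 0"
    unfolding a_def by (rule cinner_orthogonal_residual)
  moreover have "cinner (\<Sum>g\<in>F. c g *\<^sub>C g) ?y = 0"
    using cinner_corth_sum[OF yF] cinner_eq_0_commute by blast
  ultimately have "cinner f ?y = 0"
    by (simp add: cinner.diff_left)
  then have "?y \<in> corth (insert f F)" using yF by (simp add: corth_def)
  moreover have "?y = x - (\<Sum>g\<in>insert f F. (if g = f then a else d g - a * c g) *\<^sub>C g)"
  proof -
    have "(\<Sum>g\<in>F. (if g = f then a else d g - a * c g) *\<^sub>C g)
        = (\<Sum>g\<in>F. d g *\<^sub>C g - a *\<^sub>C (c g *\<^sub>C g))"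
      using insert.hyps by (intro sum.cong) (auto simp: scaleC.diff_left scaleC_scaleC)
    also have "\<dots> = (\<Sum>g\<in>F. d g *\<^sub>C g) - a *\<^sub>C (\<Sum>g\<in>F. c g *\<^sub>C g)"
      by (simp add: sum_subtractf scaleC.sum_right)
    finally show ?thesis
      using insert.hyps by (simp add: scaleC.diff_right algebra_simps)
  qed
  ultimately show ?case
    by (intro exI[of _ "\<lambda>g. if g = f then a else d g - a * c g"]) (simp only:)
qed

text \<open>If only 0 were orthogonal to \<open>F\<close>, the decomposition above would let
  \<open>F\<close> span the whole space.\<close>

lemma corth_unit_vector:
  fixes F :: "'a::complex_inner set"
  assumes "infinite_dimensional TYPE('a)" and "finite F"
  obtains x where "x \<in> corth F" "norm x = 1"
proof -
  have "\<exists>x::'a. x \<in> corth F \<and> x \<noteq> 0"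
  proof (rule ccontr)
    assume "\<not> ?thesis"
    then have "\<exists>c. x = (\<Sum>f\<in>F. c f *\<^sub>C f)" for x :: 'a
      using corth_decomposition[OF assms(2), of x] by (metis eq_iff_diff_eq_0)
    then show False
      using assms by (simp add: infinite_dimensional_def cfinite_dim_def) blast
  qed
  then show ?thesis
    using that csubspace_normalize[OF csubspace_corth] by (metis norm_sgn)
qed

text \<open>One condition \<open>cinner f x = 0\<close> lowers the dimension of \<open>W\<close> by
  at most one: once some \<open>g\<close> in \<open>W\<close> is not orthogonal to \<open>f\<close>,
  every vector of \<open>W\<close> is a multiple of \<open>g\<close> plus a vector of
  \<open>W\<close> in \<open>corth {f}\<close>.\<close>

lemma cfinite_dim_if_trivial_corth:
  fixes W :: "'a::complex_inner set"
  assumes "finite F" "csubspace W" "W \<inter> corth F \<subseteq> {0}"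
  shows "cfinite_dim W"
  using assms
proof (induction F arbitrary: W)
  case empty
  then show ?case by (auto simp: corth_def cfinite_dim_def intro!: exI[of _ "{}"])
next
  case (insert f F)
  have "cfinite_dim (W \<inter> corth {f})"
    using insert.prems
    by (intro insert.IH csubspace_Int csubspace_corth) (auto simp: corth_insert[of f F])
  then obtain G where G: "finite G" "\<forall>x\<in>W \<inter> corth {f}. \<exists>c. x = (\<Sum>g\<in>G. c g *\<^sub>C g)"
    by (auto simp: cfinite_dim_def)
  show ?case
  proof (cases "W \<subseteq> corth {f}")
    case True
    then show ?thesis using G by (auto simp: cfinite_dim_def Int_absorb2)
  next
    case False
    then obtain g where g: "g \<in> W" "cinner f g \<noteq> 0" by (auto simp: corth_def)
    have "\<exists>c. x = (\<Sum>h\<in>insert g G. c h *\<^sub>C h)" if x: "x \<in> W" for x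
    proof -
      define a where "a = cinner f x / cinner f g"
      have "x - a *\<^sub>C g \<in> W"
        using x g insert.prems(1) by (intro csubspace_diff csubspace_scaleC)
      moreover have "x - a *\<^sub>C g \<in> corth {f}"
        using g by (simp add: corth_def a_def cinner.diff_right cinner_scaleC_right)
      ultimately obtain c where c: "x - a *\<^sub>C g = (\<Sum>h\<in>G. c h *\<^sub>C h)" using G(2) by blast
      \<comment> \<open>\<open>g\<close> may already belong to \<open>G\<close>, so \<open>c\<close>
        is first set to 0 off \<open>G\<close> and \<open>a\<close> is then added at
        \<open>g\<close>; this is right in both cases.\<close>
      define c' where "c' = (\<lambda>h. if h \<in> G then c h else 0)"
      have "(\<Sum>h\<in>insert g G. (c' h + (if h = g then a else 0)) *\<^sub>C h)
          = (\<Sum>h\<in>insert g G. c' h *\<^sub>C h) + (\<Sum>h\<in>insert g G. (if h = g then a *\<^sub>C h else 0))"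
        unfolding sum.distrib[symmetric] by (intro sum.cong) (auto simp: scaleC.add_left scaleC.zero_left)
      also have "(\<Sum>h\<in>insert g G. (if h = g then a *\<^sub>C h else 0)) = a *\<^sub>C g"
        using G(1) by (subst sum.delta) auto
      also have "(\<Sum>h\<in>insert g G. c' h *\<^sub>C h) = (\<Sum>h\<in>G. c h *\<^sub>C h)"
        using G(1) by (intro sum.mono_neutral_cong_right) (auto simp: c'_def scaleC.zero_left)
      finally have "x = (\<Sum>h\<in>insert g G. (c' h + (if h = g then a else 0)) *\<^sub>C h)"
        using c by (simp add: algebra_simps)
      then show ?thesis by (rule exI[of "\<lambda>c. x = (\<Sum>h\<in>insert g G. c h *\<^sub>C h)"])
    qed
    then show ?thesis using G(1) unfolding cfinite_dim_def by blast
  qed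
qed

text \<open>Dependent choice on pairs of a vector and a finite set of constraints; each step adds
  the new vector and its image under \<open>B\<close> to the constraints. With \<open>B\<close> the
  square of a symmetric \<open>A\<close>, the images \<open>A (e i)\<close> become orthogonal
  too.\<close>

lemma orthogonal_sequence:
  fixes B :: "'a::complex_inner \<Rightarrow> 'a" and P :: "nat \<Rightarrow> 'a \<Rightarrow> bool"
  assumes "\<And>G n. finite G \<Longrightarrow> \<exists>x\<in>corth G. P n x"
  shows "\<exists>e. \<forall>n. P n (e n) \<and> (\<forall>i<n. cinner (e i) (e n) = 0 \<and> cinner (B (e i)) (e n) = 0)"
proof -
  have "\<exists>s. \<forall>n. (finite (snd (s n)) \<and> P n (fst (s n)) \<and> fst (s n) \<in> corth (snd (s n)))
      \<and> insert (fst (s n)) (insert (B (fst (s n))) (snd (s n))) \<subseteq> snd (s (Suc n))"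
  proof (rule dependent_nat_choice)
    show "\<exists>x. finite (snd x) \<and> P 0 (fst x) \<and> fst x \<in> corth (snd x)"
      using assms[of "{}" 0] by force
  next
    fix x :: "'a \<times> 'a set" and n
    assume x: "finite (snd x) \<and> P n (fst x) \<and> fst x \<in> corth (snd x)"
    let ?G = "insert (fst x) (insert (B (fst x)) (snd x))"
    obtain y where "y \<in> corth ?G" "P (Suc n) y" using assms[of ?G "Suc n"] x by auto
    then show "\<exists>y. (finite (snd y) \<and> P (Suc n) (fst y) \<and> fst y \<in> corth (snd y))
        \<and> insert (fst x) (insert (B (fst x)) (snd x)) \<subseteq> snd y"
      using x by (intro exI[of _ "(y, ?G)"]) auto
  qed
  then obtain s where s: "\<And>n. P n (fst (s n))" "\<And>n. fst (s n) \<in> corth (snd (s n))"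
    "\<And>n. insert (fst (s n)) (insert (B (fst (s n))) (snd (s n))) \<subseteq> snd (s (Suc n))"
    by blast
  have mono: "snd (s i) \<subseteq> snd (s n)" if "i \<le> n" for i n
    using that by (rule lift_Suc_mono_le[rotated]) (use s(3) in blast)
  have "fst (s i) \<in> snd (s n) \<and> B (fst (s i)) \<in> snd (s n)" if "i < n" for i n
    using s(3)[of i] mono[of "Suc i" n] that by auto
  then show ?thesis
    using s(1,2) by (intro exI[of _ "\<lambda>n. fst (s n)"]) (auto simp: corth_def)
qed

section \<open>Coercive quadratic forms and attained minima\<close>

lemma parallelogram_law:
  "(norm (x + y))\<^sup>2 + (norm (x - y))\<^sup>2 = 2 * (norm x)\<^sup>2 + 2 * (norm (y::'a::complex_inner))\<^sup>2"
  using norm_add_sq[of x y] norm_add_sq[of x "- y"] by (simp add: cinner.minus_right)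

text \<open>If the quadratic form \<open>r\<close> is coercive on all of \<open>W\<close>, an
  \<open>r\<close>-Cauchy sequence is Cauchy in norm. Each \<open>f\<close> costs one passage to a
  subsequence: the coefficients along a fixed \<open>g\<close> with \<open>cinner f g = 1\<close>
  are bounded, hence converge along a subsequence, and the rest of the sequence lies in
  \<open>corth {f}\<close>.\<close>

lemma coercive_convergent_subsequence:
  fixes r :: "'a::chilbert_space \<Rightarrow> real"
  assumes par: "\<And>x y. r (x + y) + r (x - y) = 2 * r x + 2 * r y"
    and hom: "\<And>c x. r (c *\<^sub>C x) = (cmod c)\<^sup>2 * r x"
    and "c > 0" "finite F" "csubspace W" "\<And>x. x \<in> W \<Longrightarrow> 0 \<le> r x"
    and "\<And>x. x \<in> W \<Longrightarrow> x \<in> corth F \<Longrightarrow> c * (norm x)\<^sup>2 \<le> r x"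
    and "\<And>n. x n \<in> W" "\<And>n. norm (x n) \<le> B"
    and "\<And>e. e > 0 \<Longrightarrow> \<exists>N. \<forall>n\<ge>N. \<forall>k\<ge>N. r (x n - x k) < e"
  shows "\<exists>l s. strict_mono (s::nat \<Rightarrow> nat) \<and> (x \<circ> s) \<longlonglongrightarrow> l"
  using assms(4-)
proof (induction F arbitrary: W x B)
  case empty
  have "Cauchy x"
    unfolding Cauchy_iff
  proof (intro allI impI)
    fix e :: real assume "e > 0"
    then obtain N where N: "\<And>n k. n \<ge> N \<Longrightarrow> k \<ge> N \<Longrightarrow> r (x n - x k) < c * e\<^sup>2"
      using empty.prems(6)[of "c * e\<^sup>2"] \<open>c > 0\<close> by auto
    have "norm (x n - x k) < e" if "n \<ge> N" "k \<ge> N" for n k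
    proof -
      have "c * (norm (x n - x k))\<^sup>2 \<le> r (x n - x k)"
        by (rule empty.prems(3)[OF csubspace_diff[OF empty.prems(1,4,4)]]) (simp add: corth_def)
      also have "\<dots> < c * e\<^sup>2" by (rule N[OF that])
      finally show ?thesis using \<open>c > 0\<close> \<open>e > 0\<close> by (simp add: power_less_imp_less_base)
    qed
    then show "\<exists>M. \<forall>m\<ge>M. \<forall>n\<ge>M. norm (x m - x n) < e" by blast
  qed
  then obtain l where "x \<longlonglongrightarrow> l" using Cauchy_convergent convergent_def by blast
  then show ?case by (intro exI[of _ l] exI[of _ id]) (simp add: strict_mono_def)
next
  case (insert f F)
  show ?case
  proof (cases "W \<subseteq> corth {f}")
    case True
    show ?thesis
      by (rule insert.IH[OF insert.prems(1,2) _ insert.prems(4-6)])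
        (use True insert.prems(3) in \<open>auto simp: corth_insert[of f F]\<close>)
  next
    case False
    then obtain g0 where g0: "g0 \<in> W" "cinner f g0 \<noteq> 0" by (auto simp: corth_def)
    define g where "g = (1 / cinner f g0) *\<^sub>C g0"
    have g: "g \<in> W" "cinner f g = 1"
      using g0 insert.prems(1) by (auto simp: g_def cinner_scaleC_right csubspace_scaleC)
    define a where "a n = cinner f (x n)" for n
    have a_le: "cmod (a n) \<le> norm f * B" for n
      unfolding a_def
      by (rule order_trans[OF Cauchy_Schwarz_cinner]) (simp add: insert.prems(5) mult_left_mono)
    then have "bounded (range a)" by (auto simp: bounded_iff)
    then obtain \<alpha> s where s: "strict_mono (s :: nat \<Rightarrow> nat)" "(a \<circ> s) \<longlonglongrightarrow> \<alpha>"
      using bounded_imp_convergent_subsequence by blast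
    define z where "z n = x (s n) - a (s n) *\<^sub>C g" for n
    have "\<exists>l t. strict_mono (t::nat \<Rightarrow> nat) \<and> (z \<circ> t) \<longlonglongrightarrow> l"
    proof (rule insert.IH[of "W \<inter> corth {f}" z "B + norm f * B * norm g"])
      show "csubspace (W \<inter> corth {f})"
        by (intro csubspace_Int insert.prems(1) csubspace_corth)
      show "z n \<in> W \<inter> corth {f}" for n
        using g insert.prems(1,4)
        by (auto simp: z_def corth_def cinner.diff_right cinner_scaleC_right a_def
            intro!: csubspace_diff csubspace_scaleC)
      show "norm (z n) \<le> B + norm f * B * norm g" for n
        unfolding z_def
        by (rule order_trans[OF norm_triangle_ineq4])
          (simp add: norm_scaleC add_mono insert.prems(5) a_le mult_right_mono)
      show "0 \<le> r y" if "y \<in> W \<inter> corth {f}" for y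
        using that insert.prems(2) by blast
      show "c * (norm y)\<^sup>2 \<le> r y" if "y \<in> W \<inter> corth {f}" "y \<in> corth F" for y
        using that by (intro insert.prems(3)) (auto simp: corth_def)
      fix e :: real assume "e > 0"
      obtain N1 where N1: "\<And>n k. n \<ge> N1 \<Longrightarrow> k \<ge> N1 \<Longrightarrow> r (x n - x k) < e / 4"
        using insert.prems(6)[of "e / 4"] \<open>e > 0\<close> by auto
      \<comment> \<open>Coefficients of modulus below \<open>d\<close> keep \<open>r\<close> of the
        corresponding multiple of \<open>g\<close> at most \<open>e / 4\<close>; the
        \<open>+ 1\<close> keeps the denominator positive when \<open>r g = 0\<close>.\<close>
      define d where "d = sqrt (e / (4 * (r g + 1)))"
      have rg: "0 \<le> r g" by (rule insert.prems(2)[OF g(1)])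
      have d: "d > 0" "d\<^sup>2 * (r g + 1) = e / 4"
        using \<open>e > 0\<close> rg by (auto simp: d_def field_simps)
      obtain N2 where N2: "\<And>n k. n \<ge> N2 \<Longrightarrow> k \<ge> N2 \<Longrightarrow> cmod (a (s n) - a (s k)) < d"
        using LIMSEQ_imp_Cauchy[OF s(2)] \<open>d > 0\<close> unfolding Cauchy_iff comp_def by blast
      have "r (z n - z k) < e" if "n \<ge> max N1 N2" "k \<ge> max N1 N2" for n k
      proof -
        \<comment> \<open>The parallelogram identity and nonnegativity of \<open>r (?u + ?v)\<close>
          bound \<open>r (?u - ?v)\<close> by \<open>2 * r ?u + 2 * r ?v\<close>, where each summand
          is at most \<open>e / 2\<close> and the first is strictly less.\<close>
        let ?u = "x (s n) - x (s k)" and ?v = "(a (s n) - a (s k)) *\<^sub>C g"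
        have "z n - z k = ?u - ?v" by (simp add: z_def scaleC.diff_left)
        moreover have "0 \<le> r (?u + ?v)"
          using insert.prems(1,4) g
          by (intro insert.prems(2)) (meson csubspace_def csubspace_diff)
        ultimately have "r (z n - z k) \<le> 2 * r ?u + 2 * r ?v" using par[of ?u ?v] by simp
        moreover have "r ?u < e / 4"
          using that seq_suble[OF s(1), of n] seq_suble[OF s(1), of k] by (intro N1) auto
        moreover have "r ?v \<le> e / 4"
        proof -
          have "r ?v \<le> d\<^sup>2 * (r g + 1)"
            unfolding hom using N2[of n k] that rg
            by (intro mult_mono power_mono) auto
          then show ?thesis using d by simp
        qed
        ultimately show ?thesis by linarith
      qed
      then show "\<exists>N. \<forall>n\<ge>N. \<forall>k\<ge>N. r (z n - z k) < e" by blast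
    qed
    then obtain l t where t: "strict_mono (t::nat \<Rightarrow> nat)" "(z \<circ> t) \<longlonglongrightarrow> l" by blast
    have "(\<lambda>n. z (t n) + a (s (t n)) *\<^sub>C g) \<longlonglongrightarrow> l + \<alpha> *\<^sub>C g"
      using t(2) LIMSEQ_subseq_LIMSEQ[OF s(2) t(1)]
      by (intro tendsto_add scaleC.tendsto tendsto_const) (auto simp: comp_def)
    then have "(x \<circ> (s \<circ> t)) \<longlonglongrightarrow> l + \<alpha> *\<^sub>C g" by (simp add: z_def comp_def)
    then show ?thesis using strict_mono_o[OF s(1) t(1)] by blast
  qed
qed

text \<open>The asymmetry matters. The norms of \<open>T\<close> at unit vectors may approach
  \<beta> from below along an orthonormal sequence, hence the slack \<open>e\<close>; an approach
  strictly from above would produce an unattained infimum, hence the exact upper bound.\<close>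

definition limit_modulus :: "('a::complex_inner \<Rightarrow> 'b::complex_inner) \<Rightarrow> real \<Rightarrow> bool" where
  "limit_modulus T \<beta> \<longleftrightarrow>
     (\<forall>e>0. \<exists>F. finite F \<and> (\<forall>x\<in>corth F. (\<beta> - e) * norm x \<le> norm (T x))) \<and>
     (\<exists>F. finite F \<and> (\<forall>x\<in>corth F. norm (T x) \<le> \<beta> * norm x))"

lemma min_modulus_le:
  assumes "csubspace M" "bounded_clinear T" "x \<in> M"
  shows "min_modulus_on T M * norm x \<le> norm (T x)"
proof (cases "x = 0")
  case False
  interpret T: bounded_linear T by (rule bounded_clinear_imp_bounded_linear) fact
  have "min_modulus_on T M \<le> norm (T (sgn x))"
    unfolding min_modulus_on_def
    using csubspace_normalize[OF assms(1,3)] False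
    by (intro cInf_lower bdd_belowI[of _ 0]) (auto simp: norm_sgn)
  then show ?thesis using False by (simp add: sgn_div_norm T.scaleR field_simps)
qed simp

text \<open>The form \<open>r\<close> below is nonnegative on \<open>M\<close> and tends to 0 along
  a minimizing sequence of unit vectors. The parallelogram law makes this sequence
  \<open>r\<close>-Cauchy, and the limit of a convergent subsequence is a minimizing unit vector of
  \<open>M\<close>.\<close>

lemma min_attaining_if_coercive:
  fixes T :: "'a::chilbert_space \<Rightarrow> 'b::complex_inner"
  assumes T: "bounded_clinear T" and M: "closed_csubspace M" "M \<noteq> {0}"
    and "finite F" "c > 0"
    and coer: "\<And>x. x \<in> M \<Longrightarrow> x \<in> corth F \<Longrightarrow>
      c * (norm x)\<^sup>2 \<le> (norm (T x))\<^sup>2 - (min_modulus_on T M)\<^sup>2 * (norm x)\<^sup>2"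
  shows "min_attaining_on T M"
proof -
  interpret T: bounded_linear T by (rule bounded_clinear_imp_bounded_linear) fact
  have cM: "closed M" "csubspace M" using M(1) by (auto simp: closed_csubspace_iff)
  define m where "m = min_modulus_on T M"
  obtain u where "u \<in> M" "u \<noteq> 0" using M(2) cM(2) by (auto simp: csubspace_def)
  then have u: "sgn u \<in> M" "norm (sgn u) = 1"
    using csubspace_normalize[OF cM(2)] by (auto simp: norm_sgn)
  have m0: "m \<ge> 0"
    unfolding m_def min_modulus_on_def using u by (intro cInf_greatest) auto
  have m_le: "m * norm x \<le> norm (T x)" if "x \<in> M" for x
    unfolding m_def by (rule min_modulus_le[OF cM(2) T that])
  define r where "r x = (norm (T x))\<^sup>2 - m\<^sup>2 * (norm x)\<^sup>2" for x
  have r0: "0 \<le> r x" if "x \<in> M" for x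
    using power_mono[OF m_le[OF that], of 2] m0 by (simp add: r_def power_mult_distrib)
  have par: "r (x + y) + r (x - y) = 2 * r x + 2 * r y" for x y
    using parallelogram_law[of x y] parallelogram_law[of "T x" "T y"]
    unfolding r_def T.add T.diff by algebra
  have hom: "r (a *\<^sub>C x) = (cmod a)\<^sup>2 * r x" for a x
    by (simp add: r_def bounded_clinear_scaleC[OF T] norm_scaleC power_mult_distrib algebra_simps)
  have "\<exists>x. x \<in> M \<and> norm x = 1 \<and> norm (T x) < m + inverse (real (Suc n))" for n
  proof -
    have "Inf ((\<lambda>x. norm (T x)) ` {x\<in>M. norm x = 1}) < m + inverse (real (Suc n))"
      by (simp add: m_def min_modulus_on_def)
    from cInf_lessD[OF _ this] u show ?thesis by auto
  qed
  then obtain x where x: "\<And>n. x n \<in> M" "\<And>n. norm (x n) = 1"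
    "\<And>n. norm (T (x n)) < m + inverse (real (Suc n))" by metis
  have Tx: "(\<lambda>n. norm (T (x n))) \<longlonglongrightarrow> m"
  proof (rule tendsto_sandwich)
    show "\<forall>\<^sub>F n in sequentially. m \<le> norm (T (x n))" using m_le[OF x(1)] x(2) by simp
    show "\<forall>\<^sub>F n in sequentially. norm (T (x n)) \<le> m + inverse (real (Suc n))"
      using x(3) less_imp_le by (intro always_eventually) blast
    show "(\<lambda>n. m + inverse (real (Suc n))) \<longlonglongrightarrow> m"
      by (rule LIMSEQ_inverse_real_of_nat_add)
  qed simp
  have "(\<lambda>n. r (x n)) \<longlonglongrightarrow> m\<^sup>2 - m\<^sup>2 * 1\<^sup>2"
    unfolding r_def x(2) by (intro tendsto_intros Tx)
  then have rx: "(\<lambda>n. r (x n)) \<longlonglongrightarrow> 0" by simp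
  have "\<exists>l s. strict_mono (s::nat \<Rightarrow> nat) \<and> (x \<circ> s) \<longlonglongrightarrow> l"
  proof (rule coercive_convergent_subsequence[OF par hom \<open>c > 0\<close> \<open>finite F\<close> cM(2) r0])
    show "c * (norm y)\<^sup>2 \<le> r y" if "y \<in> M" "y \<in> corth F" for y
      using coer[OF that] by (simp add: r_def m_def)
    show "x n \<in> M" "norm (x n) \<le> 1" for n using x by auto
    fix e :: real assume "e > 0"
    then have "\<forall>\<^sub>F n in sequentially. r (x n) < e / 4"
      by (intro order_tendstoD(2)[OF rx]) auto
    then obtain N where N: "\<And>n. n \<ge> N \<Longrightarrow> r (x n) < e / 4"
      by (auto simp: eventually_sequentially)
    have "r (x n - x k) < e" if "n \<ge> N" "k \<ge> N" for n k
    proof -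
      have "0 \<le> r (x n + x k)"
        using cM(2) x(1) by (intro r0) (auto simp: csubspace_def)
      then show ?thesis using par[of "x n" "x k"] N[OF that(1)] N[OF that(2)] by linarith
    qed
    then show "\<exists>N. \<forall>n\<ge>N. \<forall>k\<ge>N. r (x n - x k) < e" by blast
  qed
  then obtain l s where s: "strict_mono (s::nat \<Rightarrow> nat)" "(x \<circ> s) \<longlonglongrightarrow> l" by blast
  have "l \<in> M" by (rule closed_sequentially[OF cM(1) _ s(2)]) (simp add: x(1))
  moreover have "norm l = 1"
    using tendsto_norm[OF s(2)] x(2) by (simp add: LIMSEQ_const_iff)
  moreover have "norm (T l) = m"
  proof (rule LIMSEQ_unique)
    show "(\<lambda>n. norm (T ((x \<circ> s) n))) \<longlonglongrightarrow> norm (T l)"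
      by (intro tendsto_norm T.tendsto s(2))
    show "(\<lambda>n. norm (T ((x \<circ> s) n))) \<longlonglongrightarrow> m"
      using LIMSEQ_subseq_LIMSEQ[OF Tx s(1)] by (simp add: comp_def)
  qed
  ultimately show ?thesis unfolding min_attaining_on_def m_def by blast
qed

lemma abs_min_attaining_if_limit_modulus:
  fixes T :: "'a::chilbert_space \<Rightarrow> 'b::complex_inner"
  assumes T: "bounded_clinear T" and lim: "limit_modulus T \<beta>"
  shows "abs_min_attaining T"
  unfolding abs_min_attaining_def
proof (intro conjI allI impI T)
  fix M :: "'a set" assume M: "closed_csubspace M \<and> M \<noteq> {0}"
  interpret T: bounded_linear T by (rule bounded_clinear_imp_bounded_linear) fact
  have cM: "csubspace M" using M by (simp add: closed_csubspace_iff)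
  define m where "m = min_modulus_on T M"
  show "min_attaining_on T M"
  proof (cases "m < \<beta>")
    case True
    \<comment> \<open>Half the gap between \<open>m\<close> and \<beta> as slack puts the lower
      bound at their midpoint \<open>?b\<close>, still strictly above \<open>m\<close>; the
      coercivity constant is then a difference of squares.\<close>
    obtain F where F: "finite F" "\<And>x. x \<in> corth F \<Longrightarrow> (\<beta> - (\<beta> - m) / 2) * norm x \<le> norm (T x)"
      using lim True unfolding limit_modulus_def
      by (metis diff_gt_0_iff_gt half_gt_zero)
    obtain u where "u \<in> M" "u \<noteq> 0" using M cM by (auto simp: csubspace_def)
    then have m0: "0 \<le> m"
      unfolding m_def min_modulus_on_def using csubspace_normalize[OF cM]
      by (intro cInf_greatest) (force simp: norm_sgn)+
    let ?b = "(\<beta> + m) / 2"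
    have b: "\<beta> - (\<beta> - m) / 2 = ?b" by (simp add: field_simps)
    show ?thesis
    proof (rule min_attaining_if_coercive[OF T _ _ F(1), of _ "?b\<^sup>2 - m\<^sup>2"])
      show "?b\<^sup>2 - m\<^sup>2 > 0" using True m0 by (simp add: power_strict_mono)
      fix x assume "x \<in> M" "x \<in> corth F"
      then have "(?b * norm x)\<^sup>2 \<le> (norm (T x))\<^sup>2"
        using F(2)[of x] True m0 unfolding b by (intro power_mono) auto
      then show "(?b\<^sup>2 - m\<^sup>2) * (norm x)\<^sup>2 \<le> (norm (T x))\<^sup>2 - (min_modulus_on T M)\<^sup>2 * (norm x)\<^sup>2"
        unfolding m_def[symmetric] by (simp only: power_mult_distrib left_diff_distrib diff_right_mono)
    qed (use M in auto)
  next
    case False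
    obtain F where F: "finite F" "\<And>x. x \<in> corth F \<Longrightarrow> norm (T x) \<le> \<beta> * norm x"
      using lim unfolding limit_modulus_def by blast
    show ?thesis
    proof (cases "M \<inter> corth F \<subseteq> {0}")
      case True
      \<comment> \<open>Coercivity is trivial here, since 0 is the only vector to test.\<close>
      show ?thesis
        by (rule min_attaining_if_coercive[OF T _ _ F(1), of _ 1])
          (use M True T.zero in auto)
    next
      case nontriv: False
      then obtain x where "x \<in> M \<inter> corth F" "x \<noteq> 0" by blast
      then have x: "sgn x \<in> M \<inter> corth F" "norm (sgn x) = 1"
        using csubspace_normalize[OF csubspace_Int[OF cM csubspace_corth]] by (auto simp: norm_sgn)
      have "norm (T (sgn x)) = m"
        using F(2)[of "sgn x"] min_modulus_le[OF cM T, of "sgn x"] x False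
        unfolding m_def by simp
      then show ?thesis using x unfolding min_attaining_on_def m_def by blast
    qed
  qed
qed

section \<open>Positive absolutely minimum attaining operators have a limit modulus\<close>

lemma positive_op_symmetric:
  assumes "positive_op A"
  shows "cinner (A x) y = cinner x (A y)"
proof -
  have A: "bounded_clinear A" and im: "\<And>u. Im (cinner u (A u)) = 0"
    using assms by (auto simp: positive_op_def)
  interpret A: bounded_linear A by (rule bounded_clinear_imp_bounded_linear) fact
  \<comment> \<open>Polarization: reality of the form at \<open>x + y\<close>, and next at
    \<open>x + i y\<close>, relates the imaginary and then the real parts of the two mixed
    terms.\<close>
  have "Im (cinner x (A y)) + Im (cinner y (A x)) = 0"
    using im[of "x + y"] im[of x] im[of y]
    by (simp add: A.add cinner.add_left cinner.add_right)
  moreover have "Re (cinner x (A y)) = Re (cinner y (A x))"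
    using im[of "x + \<i> *\<^sub>C y"] im[of x] im[of y]
    by (simp add: A.add cinner.add_left cinner.add_right bounded_clinear_scaleC[OF A]
        cinner_scaleC_left cinner_scaleC_right)
  ultimately have "cinner x (A y) = cnj (cinner y (A x))"
    by (simp add: complex_eq_iff)
  then show ?thesis by (simp add: cinner_commute[of "A x" y])
qed

text \<open>On the closed span of such a sequence the infimum of the norm of \<open>A\<close> over the
  unit sphere is \<open>\<beta>\<close>, and it is not attained.\<close>

lemma abs_min_attaining_no_decreasing_sequence:
  fixes A :: "'a::complex_inner \<Rightarrow> 'b::complex_inner"
  assumes AM: "abs_min_attaining A" and "0 \<le> \<beta>"
    and v1: "\<And>n. norm (v n) = 1"
    and orth: "\<And>i n. i < n \<Longrightarrow> cinner (v i) (v n) = 0"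
    and Aorth: "\<And>i n. i < n \<Longrightarrow> cinner (A (v i)) (A (v n)) = 0"
    and gt: "\<And>n. \<beta> < norm (A (v n))"
    and lim: "(\<lambda>n. norm (A (v n))) \<longlonglongrightarrow> \<beta>"
  shows False
proof -
  have bA: "bounded_clinear A" using AM by (simp add: abs_min_attaining_def)
  interpret A: bounded_linear A by (rule bounded_clinear_imp_bounded_linear) fact
  note AC = bounded_clinear_scaleC[OF bA]
  have orth': "cinner (v i) (v n) = 0" "cinner (A (v i)) (A (v n)) = 0" if "i \<noteq> n" for i n
    using that orth[of i n] orth[of n i] Aorth[of i n] Aorth[of n i]
    by (metis cinner_eq_0_commute nat_neq_iff)+
  \<comment> \<open>Coefficient functions vanish from \<open>N\<close> on, so combinations can be
    lengthened freely, as adding two of different length requires.\<close>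
  define S where "S = {x. \<exists>c N. (\<forall>i\<ge>N. c i = 0) \<and> x = (\<Sum>i<N. c i *\<^sub>C v i)}"
  have v_S: "v n \<in> S" for n
    unfolding S_def
    by (intro CollectI exI[of _ "\<lambda>i. if i = n then 1 else 0"] exI[of _ "Suc n"])
      (simp add: scaleC.zero_left scaleC_one)
  have extend: "(\<Sum>i<N. c i *\<^sub>C v i) = (\<Sum>i<N'. c i *\<^sub>C v i)"
    if "N \<le> N'" "\<forall>i\<ge>N. c i = 0" for c N N'
    using that by (intro sum.mono_neutral_left) (auto simp: scaleC.zero_left)
  have S: "csubspace S"
    unfolding csubspace_def
  proof (intro conjI ballI allI)
    show "0 \<in> S" unfolding S_def by (intro CollectI exI[of _ "\<lambda>_. 0"] exI[of _ 0]) simp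
    fix x assume "x \<in> S"
    then obtain c N where x: "\<forall>i\<ge>N. c i = 0" "x = (\<Sum>i<N. c i *\<^sub>C v i)"
      unfolding S_def by blast
    show "a *\<^sub>C x \<in> S" for a
      unfolding S_def using x
      by (intro CollectI exI[of _ "\<lambda>i. a * c i"] exI[of _ N])
        (simp add: scaleC.sum_right scaleC_scaleC)
    fix y assume "y \<in> S"
    then obtain d N' where y: "\<forall>i\<ge>N'. d i = 0" "y = (\<Sum>i<N'. d i *\<^sub>C v i)"
      unfolding S_def by blast
    have "x + y = (\<Sum>i<max N N'. (c i + d i) *\<^sub>C v i)"
      using extend[of N "max N N'" c] extend[of N' "max N N'" d] x y
      by (simp add: scaleC.add_left sum.distrib)
    then show "x + y \<in> S"
      unfolding S_def using x(1) y(1)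
      by (intro CollectI exI[of _ "\<lambda>i. c i + d i"] exI[of _ "max N N'"]) simp
  qed
  define M where "M = closure S"
  have M: "csubspace M" "closed M" "S \<subseteq> M"
    unfolding M_def
  proof -
    show "csubspace (closure S)"
      unfolding csubspace_def
    proof (intro conjI ballI allI)
      show "0 \<in> closure S" using S closure_subset by (auto simp: csubspace_def)
      fix x assume "x \<in> closure S"
      then obtain p where p: "\<And>n. p n \<in> S" "p \<longlonglongrightarrow> x" by (auto simp: closure_sequential)
      show "a *\<^sub>C x \<in> closure S" for a
        unfolding closure_sequential using p csubspace_scaleC[OF S]
        by (intro exI[of _ "\<lambda>n. a *\<^sub>C p n"] conjI allI scaleC.tendsto tendsto_const) auto
      fix y assume "y \<in> closure S"
      then obtain q where q: "\<And>n. q n \<in> S" "q \<longlonglongrightarrow> y" by (auto simp: closure_sequential)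
      show "x + y \<in> closure S"
        unfolding closure_sequential using p q S
        by (intro exI[of _ "\<lambda>n. p n + q n"] conjI allI tendsto_add) (auto simp: csubspace_def)
    qed
  qed (auto simp: closure_subset)
  define r where "r x = (norm (A x))\<^sup>2 - \<beta>\<^sup>2 * (norm x)\<^sup>2" for x
  have r_scale: "r (a *\<^sub>C x) = (cmod a)\<^sup>2 * r x" for a x
    by (simp add: r_def AC norm_scaleC power_mult_distrib algebra_simps)
  have r_add: "r (x + y) = r x + r y" if "cinner x y = 0" "cinner (A x) (A y) = 0" for x y
    using that by (simp add: r_def A.add norm_pythagoras algebra_simps)
  have r_v: "0 < r (v n)" for n
    using gt[of n] \<open>0 \<le> \<beta>\<close> by (simp add: r_def v1 power_strict_mono)
  \<comment> \<open>Orthogonality of the \<open>v i\<close> and of their images makes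
    \<open>r\<close> diagonal on \<open>S\<close> with positive entries \<open>r (v i)\<close>;
    continuity carries nonnegativity over to \<open>M\<close>.\<close>
  have "0 \<le> r (\<Sum>i<N. c i *\<^sub>C v i)" for c N
  proof (induction N)
    case (Suc N)
    have "cinner (\<Sum>i<N. c i *\<^sub>C v i) (c N *\<^sub>C v N) = 0"
      by (simp add: cinner.sum_left cinner_scaleC_left cinner_scaleC_right orth)
    moreover have "cinner (A (\<Sum>i<N. c i *\<^sub>C v i)) (A (c N *\<^sub>C v N)) = 0"
      by (simp add: A.sum AC cinner.sum_left cinner_scaleC_left cinner_scaleC_right Aorth)
    ultimately show ?case using Suc r_v[of N] by (simp add: r_add r_scale)
  qed (simp add: r_def A.zero)
  then have "S \<subseteq> {x. 0 \<le> r x}" unfolding S_def by blast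
  moreover have "closed {x. 0 \<le> r x}"
    unfolding r_def
    by (intro closed_Collect_le continuous_intros A.continuous_on)
  ultimately have r_nonneg: "0 \<le> r x" if "x \<in> M" for x
    using that closure_minimal unfolding M_def by blast
  \<comment> \<open>On \<open>M\<close> each \<open>v n\<close> acts like an eigenvector of the
    adjoint of \<open>A\<close> times \<open>A\<close>, so orthogonality to \<open>v n\<close>
    passes to the images. This holds termwise on \<open>S\<close> and by continuity on its
    closure.\<close>
  have pair: "cinner (A (v n)) (A x) = (norm (A (v n)))\<^sup>2 * cinner (v n) x" if "x \<in> M" for n x
  proof -
    have "S \<subseteq> {x. cinner (A (v n)) (A x) = (norm (A (v n)))\<^sup>2 * cinner (v n) x}"
    proof (clarsimp simp: S_def A.sum AC cinner.sum_right cinner_scaleC_right sum_distrib_left)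
      fix c N
      show "(\<Sum>i<N. c i * cinner (A (v n)) (A (v i)))
          = (\<Sum>i<N. (complex_of_real (norm (A (v n))))\<^sup>2 * (c i * cinner (v n) (v i)))"
      proof (rule sum.cong)
        show "c i * cinner (A (v n)) (A (v i))
            = (complex_of_real (norm (A (v n))))\<^sup>2 * (c i * cinner (v n) (v i))" for i
          by (cases "i = n") (simp_all add: orth' cinner_self v1)
      qed simp
    qed
    moreover have "closed {x. cinner (A (v n)) (A x) = (norm (A (v n)))\<^sup>2 * cinner (v n) x}"
      by (intro closed_Collect_eq continuous_intros A.continuous_on
          bounded_linear.continuous_on[OF cinner.bounded_linear_right])
    ultimately show ?thesis
      using that closure_minimal unfolding M_def by blast
  qed
  have "v 0 \<in> M" "v 0 \<noteq> 0" using v_S M(3) v1[of 0] by auto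
  then have "min_attaining_on A M"
    using AM M(1,2) unfolding abs_min_attaining_def closed_csubspace_iff by auto
  then obtain x where x: "x \<in> M" "norm x = 1" "norm (A x) = min_modulus_on A M"
    unfolding min_attaining_on_def by blast
  have "norm (A x) \<le> norm (A (v n))" for n
    using min_modulus_le[OF M(1) bA, of "v n"] v_S[of n] M(3) v1 x(3) by auto
  then have "norm (A x) \<le> \<beta>"
    by (intro LIMSEQ_le_const[OF lim]) auto
  then have "r x \<le> 0" using x(2) by (simp add: r_def power_mono)
  \<comment> \<open>Splitting off the component \<open>a\<close> along \<open>v n\<close> writes
    \<open>r x\<close>, which is at most 0, as a sum of two nonnegative terms, one of them a
    positive multiple of the squared modulus of \<open>a\<close>. So the minimizer is orthogonal to
    every \<open>v n\<close>, hence to \<open>M\<close> and to itself.\<close>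
  have "cinner (v n) x = 0" for n
  proof -
    define a where "a = cinner (v n) x"
    let ?x = "x - a *\<^sub>C v n"
    have "?x \<in> M" using M v_S x(1) by (intro csubspace_diff csubspace_scaleC) auto
    moreover have *: "cinner (v n) ?x = 0"
      by (simp add: cinner.diff_right cinner_scaleC_right cinner_self v1 a_def)
    ultimately have "cinner (A (v n)) (A ?x) = 0" using pair by simp
    then have "r (a *\<^sub>C v n + ?x) = r (a *\<^sub>C v n) + r ?x"
      using * by (intro r_add) (simp_all add: AC cinner_scaleC_left)
    then have "(cmod a)\<^sup>2 * r (v n) \<le> 0"
      using \<open>r x \<le> 0\<close> r_nonneg[OF \<open>?x \<in> M\<close>] by (simp add: r_scale)
    then show ?thesis
      using r_v[of n] by (simp add: mult_le_0_iff a_def)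
  qed
  then have "S \<subseteq> corth {x}"
    by (auto simp: S_def corth_def cinner.sum_left cinner_scaleC_left cinner_eq_0_commute[of x])
  then have "x \<in> corth {x}" using x(1) closure_minimal[OF _ closed_corth] unfolding M_def by blast
  then show False using x(2) by (simp add: corth_def cinner_self)
qed

text \<open>The candidate \<beta> is the supremum of the lower bounds valid on some
  \<open>corth F\<close>. If the exact upper bound failed, every \<open>corth G\<close> would
  contain unit vectors whose image norms exceed \<beta> by arbitrarily little, and an orthogonal
  sequence of them contradicts the preceding lemma.\<close>

lemma abs_min_attaining_limit_modulus:
  fixes A :: "'a::complex_inner \<Rightarrow> 'a"
  assumes pos: "positive_op A" and AM: "abs_min_attaining A"
    and inf: "infinite_dimensional TYPE('a)"
  obtains \<beta> where "0 \<le> \<beta>" "limit_modulus A \<beta>"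
proof -
  have bA: "bounded_clinear A" using AM by (simp add: abs_min_attaining_def)
  interpret A: bounded_linear A by (rule bounded_clinear_imp_bounded_linear) fact
  note AC = bounded_clinear_scaleC[OF bA]
  have sgnA: "norm (A (sgn x)) = norm (A x) / norm x" for x
    by (simp add: sgn_div_norm A.scaleR divide_inverse_commute)
  define L where "L = {b. \<exists>F. finite F \<and> (\<forall>x\<in>corth F. b * norm x \<le> norm (A x))}"
  define \<beta> where "\<beta> = Sup L"
  obtain K where K: "\<And>x. norm (A x) \<le> norm x * K" using A.bounded by blast
  have bdd: "bdd_above L"
  proof (rule bdd_aboveI)
    fix b assume "b \<in> L"
    then obtain F where F: "finite F" "\<forall>x\<in>corth F. b * norm x \<le> norm (A x)"
      by (auto simp: L_def)
    obtain x where "x \<in> corth F" "norm x = 1" by (rule corth_unit_vector[OF inf F(1)])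
    then show "b \<le> K" using F(2) K[of x] by force
  qed
  have "0 \<in> L" by (auto simp: L_def intro!: exI[of _ "{}"])
  then have \<beta>0: "0 \<le> \<beta>" unfolding \<beta>_def using bdd by (rule cSup_upper)
  have lower: "\<exists>F. finite F \<and> (\<forall>x\<in>corth F. (\<beta> - e) * norm x \<le> norm (A x))" if e: "e > 0" for e
  proof -
    obtain b where b: "b \<in> L" "\<beta> - e < b"
      using less_cSupD[of L "\<beta> - e"] \<open>0 \<in> L\<close> e unfolding \<beta>_def by auto
    then show ?thesis
      unfolding L_def by clarify (meson less_imp_le mult_right_mono norm_ge_zero order_trans)
  qed
  have "\<exists>F. finite F \<and> (\<forall>x\<in>corth F. norm (A x) \<le> \<beta> * norm x)"
  proof (rule ccontr)
    assume neg: "\<not> ?thesis"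
    have above: "\<exists>x\<in>corth F. norm x = 1 \<and> \<beta> < norm (A x)" if "finite F" for F
    proof -
      obtain x where x: "x \<in> corth F" "\<beta> * norm x < norm (A x)"
        using neg \<open>finite F\<close> by (auto simp: not_le)
      then have "x \<noteq> 0" by (auto simp: A.zero)
      then show ?thesis
        using x csubspace_normalize[OF csubspace_corth x(1)]
        by (intro bexI[of _ "sgn x"]) (auto simp: norm_sgn sgnA pos_less_divide_eq)
    qed
    have below: "\<exists>x\<in>corth F. norm x = 1 \<and> norm (A x) < \<beta> + e" if "finite F" "e > 0" for F e
    proof -
      have "\<beta> + e \<notin> L" using cSup_upper[OF _ bdd, of "\<beta> + e"] \<open>e > 0\<close> unfolding \<beta>_def by auto
      then obtain x where x: "x \<in> corth F" "norm (A x) < (\<beta> + e) * norm x"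
        using \<open>finite F\<close> by (auto simp: L_def not_le)
      then have "x \<noteq> 0" by (auto simp: A.zero)
      then show ?thesis
        using x csubspace_normalize[OF csubspace_corth x(1)]
        by (intro bexI[of _ "sgn x"]) (auto simp: norm_sgn sgnA pos_divide_less_eq)
    qed
    have step: "\<exists>z\<in>corth G. norm z = 1 \<and> \<beta> < norm (A z) \<and> norm (A z) < \<beta> + inverse (real (Suc n))"
      if G: "finite G" for G n
    proof -
      define e where "e = inverse (real (Suc n))"
      have "e > 0" by (simp add: e_def)
      obtain x where x: "x \<in> corth G" "norm x = 1" "\<beta> < norm (A x)" using above[OF G] by blast
      \<comment> \<open>Orthogonality of \<open>y\<close> to \<open>A (A x)\<close> makes
        \<open>A x\<close> and \<open>A y\<close> orthogonal by symmetry, so along the arc of unit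
        vectors \<open>?z\<close> between \<open>x\<close> and \<open>y\<close> the squared image
        norm interpolates linearly between \<open>p\<close> and \<open>q\<close>.\<close>
      have "finite (G \<union> {x, A (A x)})" using G by simp
      then obtain y where y: "y \<in> corth (G \<union> {x, A (A x)})" "norm y = 1" "norm (A y) < \<beta> + e"
        using below \<open>e > 0\<close> by blast
      then have yG: "y \<in> corth G" and xy: "cinner x y = 0" and "cinner (A (A x)) y = 0"
        by (auto simp: corth_def)
      then have Axy: "cinner (A x) (A y) = 0" by (simp add: positive_op_symmetric[OF pos])
      show ?thesis
      proof (cases "\<beta> < norm (A y)")
        case True
        then show ?thesis using y yG by (auto simp: e_def)
      next
        case False
        \<comment> \<open>\<open>w\<close> is the target for the squared image norm: strictly
          between the squares of \<beta> and \<open>\<beta> + e\<close>, and at most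
          \<open>p\<close>. Since \<open>q\<close> is at most the square of \<beta>, the weight
          \<open>t\<close> that reaches \<open>w\<close> lies between 0 and 1.\<close>
        define p q w where "p = (norm (A x))\<^sup>2" and "q = (norm (A y))\<^sup>2"
          and "w = min p ((\<beta> + e / 2)\<^sup>2)"
        have p: "\<beta>\<^sup>2 < p" unfolding p_def using x(3) \<beta>0 by (intro power_strict_mono) auto
        have q: "q \<le> \<beta>\<^sup>2" unfolding q_def using False by (intro power_mono) auto
        have w1: "\<beta>\<^sup>2 < w"
          unfolding w_def using p \<beta>0 \<open>e > 0\<close> by (auto intro!: power_strict_mono)
        have "(\<beta> + e / 2)\<^sup>2 < (\<beta> + e)\<^sup>2" using \<beta>0 \<open>e > 0\<close> by (intro power_strict_mono) auto
        then have w2: "w < (\<beta> + e)\<^sup>2" unfolding w_def by linarith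
        define t where "t = (w - q) / (p - q)"
        have "t * (p - q) = w - q" using p q by (simp add: t_def)
        then have t: "t * p + (1 - t) * q = w" by (simp add: algebra_simps)
        have t01: "0 \<le> t" "t \<le> 1" using p q w1 by (auto simp: t_def w_def)
        let ?z = "complex_of_real (sqrt t) *\<^sub>C x + complex_of_real (sqrt (1 - t)) *\<^sub>C y"
        have zG: "?z \<in> corth G"
          using csubspace_corth[of G] x(1) yG by (simp add: csubspace_def)
        have "(norm ?z)\<^sup>2 = 1"
          using x(2) y(2) t01 xy
          by (subst norm_pythagoras)
            (auto simp: cinner_scaleC_left cinner_scaleC_right norm_scaleC power_mult_distrib)
        then have z1: "norm ?z = 1" using power2_eq_imp_eq[of "norm ?z" 1] by simp
        have zA: "(norm (A ?z))\<^sup>2 = w"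
          using t t01 Axy unfolding A.add AC
          by (subst norm_pythagoras)
            (auto simp: cinner_scaleC_left cinner_scaleC_right norm_scaleC power_mult_distrib
              p_def q_def)
        have "\<beta> < norm (A ?z)"
          by (rule power_less_imp_less_base[of \<beta> 2]) (simp_all only: zA w1 norm_ge_zero)
        moreover have "norm (A ?z) < \<beta> + e"
          by (rule power_less_imp_less_base[of _ 2]) (use w2 zA \<beta>0 \<open>e > 0\<close> in linarith)+
        ultimately show ?thesis using z1 unfolding e_def by (intro bexI[OF _ zG] conjI)
      qed
    qed
    obtain v where "\<forall>n. (norm (v n) = 1 \<and> \<beta> < norm (A (v n)) \<and> norm (A (v n)) < \<beta> + inverse (real (Suc n)))
        \<and> (\<forall>i<n. cinner (v i) (v n) = 0 \<and> cinner (A (A (v i))) (v n) = 0)"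
      using orthogonal_sequence[of "\<lambda>n z. norm z = 1 \<and> \<beta> < norm (A z) \<and> norm (A z) < \<beta> + inverse (real (Suc n))"
          "\<lambda>z. A (A z)", OF step] by (rule exE)
    then have v: "norm (v n) = 1" "\<beta> < norm (A (v n))" "norm (A (v n)) < \<beta> + inverse (real (Suc n))"
      "i < n \<Longrightarrow> cinner (v i) (v n) = 0" "i < n \<Longrightarrow> cinner (A (A (v i))) (v n) = 0" for n i
      by blast+
    have "(\<lambda>n. norm (A (v n))) \<longlonglongrightarrow> \<beta>"
    proof (rule tendsto_sandwich)
      show "\<forall>\<^sub>F n in sequentially. \<beta> \<le> norm (A (v n))"
        "\<forall>\<^sub>F n in sequentially. norm (A (v n)) \<le> \<beta> + inverse (real (Suc n))"
        using v(2,3) by (auto intro!: always_eventually less_imp_le)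
      show "(\<lambda>n. \<beta> + inverse (real (Suc n))) \<longlonglongrightarrow> \<beta>"
        by (rule LIMSEQ_inverse_real_of_nat_add)
    qed simp
    then show False
      using abs_min_attaining_no_decreasing_sequence[OF AM \<beta>0, of v] v(1,2,4,5)
      by (simp add: positive_op_symmetric[OF pos])
  qed
  then have "limit_modulus A \<beta>" using lower unfolding limit_modulus_def by blast
  then show ?thesis using \<beta>0 that by blast
qed

section \<open>The essential spectrum of a positive operator with a limit modulus\<close>

text \<open>For \<open>D\<close>, the square of \<beta> minus the square of \<open>A\<close>, the
  form \<open>r\<close> lies between 0 and \<open>\<delta>\<close> times the squared norm on some
  \<open>corth F0\<close>, which is sharpened to \<open>norm (D x) \<le> \<delta> * norm x\<close>.
  As \<open>- D\<close> factors into \<open>A + \<beta>\<close> and \<open>A - \<beta>\<close>, and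
  positivity bounds \<open>A + \<beta>\<close> below by \<beta>, dividing by \<beta> gives the
  claim.\<close>

lemma limit_modulus_small_difference:
  fixes A :: "'a::complex_inner \<Rightarrow> 'a"
  assumes pos: "positive_op A" and lim: "limit_modulus A \<beta>" and "0 \<le> \<beta>" "0 < e"
  obtains F where "finite F" "\<And>x. x \<in> corth F \<Longrightarrow> norm (A x - \<beta> *\<^sub>R x) \<le> e * norm x"
proof -
  have bA: "bounded_clinear A" using pos by (simp add: positive_op_def)
  interpret A: bounded_linear A by (rule bounded_clinear_imp_bounded_linear) fact
  obtain F2 where F2: "finite F2" "\<And>x. x \<in> corth F2 \<Longrightarrow> norm (A x) \<le> \<beta> * norm x"
    using lim unfolding limit_modulus_def by blast
  show ?thesis
  proof (cases "\<beta> = 0")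
    case True
    then have "norm (A x - \<beta> *\<^sub>R x) \<le> e * norm x" if "x \<in> corth F2" for x
      using F2(2)[OF that] \<open>0 < e\<close> by simp
    then show ?thesis by (rule that[OF F2(1)])
  next
    case False
    with \<open>0 \<le> \<beta>\<close> have "0 < \<beta>" by simp
    define \<delta> where "\<delta> = e * \<beta>"
    have \<delta>: "0 < \<delta>" using \<open>0 < e\<close> \<open>0 < \<beta>\<close> by (simp add: \<delta>_def)
    \<comment> \<open>\<open>e1 \<le> \<beta>\<close> lets the lower bound be squared, and
      \<open>2 * e1 \<le> e\<close> makes the resulting defect at most
      \<open>\<delta>\<close>.\<close>
    define e1 where "e1 = min \<beta> (e / 2)"
    have e1: "0 < e1" "e1 \<le> \<beta>" "2 * e1 \<le> e" using \<open>0 < \<beta>\<close> \<open>0 < e\<close> by (auto simp: e1_def)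
    obtain F1 where F1: "finite F1" "\<And>x. x \<in> corth F1 \<Longrightarrow> (\<beta> - e1) * norm x \<le> norm (A x)"
      using lim e1(1) unfolding limit_modulus_def by blast
    define F0 where "F0 = F1 \<union> F2"
    define D where "D x = \<beta>\<^sup>2 *\<^sub>R x - A (A x)" for x
    have D_sym: "cinner (D x) y = cinner x (D y)" for x y
      by (simp add: D_def cinner.diff_left cinner.diff_right cinner.scaleR_left
          cinner.scaleR_right positive_op_symmetric[OF pos])
    define r where "r x = \<beta>\<^sup>2 * (norm x)\<^sup>2 - (norm (A x))\<^sup>2" for x
    have r_add: "r (x + y) = r x + r y + 2 * Re (cinner (D x) y)" for x y
      by (simp add: r_def D_def A.add norm_add_sq cinner.diff_left cinner.scaleR_left
          positive_op_symmetric[OF pos] algebra_simps)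
    have r_scale: "r (a *\<^sub>R x) = a\<^sup>2 * r x" for a x
      by (simp add: r_def A.scaleR power_mult_distrib algebra_simps)
    have r_bounds: "0 \<le> r x" "r x \<le> \<delta> * (norm x)\<^sup>2" if "x \<in> corth F0" for x
    proof -
      have x: "x \<in> corth F1" "x \<in> corth F2" using that by (auto simp: F0_def corth_Un)
      show "0 \<le> r x"
        using power_mono[OF F2(2)[OF x(2)], of 2] by (simp add: r_def power_mult_distrib)
      have "(\<beta> - e1)\<^sup>2 * (norm x)\<^sup>2 \<le> (norm (A x))\<^sup>2"
        using power_mono[OF F1(2)[OF x(1)], of 2] e1 by (simp add: power_mult_distrib)
      then have "r x \<le> (\<beta>\<^sup>2 - (\<beta> - e1)\<^sup>2) * (norm x)\<^sup>2" by (simp add: r_def algebra_simps)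
      also have "\<beta>\<^sup>2 - (\<beta> - e1)\<^sup>2 = (2 * e1) * \<beta> - e1\<^sup>2" by (simp add: power2_eq_square algebra_simps)
      also have "\<dots> \<le> \<delta>"
        using mult_right_mono[OF e1(3) \<open>0 \<le> \<beta>\<close>] zero_le_power2[of e1] unfolding \<delta>_def by linarith
      finally show "r x \<le> \<delta> * (norm x)\<^sup>2" by (simp add: mult_right_mono)
    qed
    \<comment> \<open>By symmetry of \<open>D\<close>, orthogonality of \<open>x\<close> to the
      images of \<open>F0\<close> under \<open>D\<close> puts \<open>D x\<close> itself in
      \<open>corth F0\<close>, where the bounds on \<open>r\<close> hold.\<close>
    have "norm (A x - \<beta> *\<^sub>R x) \<le> e * norm x" if x: "x \<in> corth (F0 \<union> D ` F0)" for x
    proof -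
      have x0: "x \<in> corth F0" and w0: "D x \<in> corth F0"
        using x by (auto simp: corth_def D_sym[symmetric])
      \<comment> \<open>This multiple of \<open>D x\<close> minimizes the upper estimate for
        \<open>r (x + ?y)\<close>; nonnegativity of \<open>r\<close> there is the bound on
        \<open>D x\<close>.\<close>
      let ?y = "(- (1 / \<delta>)) *\<^sub>R D x"
      have "?y \<in> corth F0"
        unfolding scaleR_scaleC by (rule csubspace_scaleC[OF csubspace_corth w0])
      then have "x + ?y \<in> corth F0"
        by (rule csubspace_add[OF csubspace_corth x0])
      then have "0 \<le> r (x + ?y)" by (rule r_bounds)
      also have "\<dots> = r x + (1 / \<delta>)\<^sup>2 * r (D x) - 2 * (norm (D x))\<^sup>2 / \<delta>"
        by (simp only: r_add r_scale cinner.scaleR_right cinner_self) simp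
      also have "\<dots> \<le> \<delta> * (norm x)\<^sup>2 + (1 / \<delta>)\<^sup>2 * (\<delta> * (norm (D x))\<^sup>2) - 2 * (norm (D x))\<^sup>2 / \<delta>"
        using r_bounds(2)[OF x0] r_bounds(2)[OF w0] by (intro diff_right_mono add_mono mult_left_mono) auto
      finally have "(norm (D x))\<^sup>2 \<le> (\<delta> * norm x)\<^sup>2"
        using \<delta> by (simp add: power_mult_distrib power2_eq_square pos_divide_le_eq mult_ac)
      then have Dx: "norm (D x) \<le> \<delta> * norm x"
        by (rule power2_le_imp_le) (use \<delta> in simp)
      let ?u = "A x - \<beta> *\<^sub>R x"
      have "A ?u + \<beta> *\<^sub>R ?u = - D x"
        unfolding D_def A.diff A.scaleR scaleR_diff_right power2_eq_square scaleR_scaleR[symmetric]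
        by simp
      then have "(norm (D x))\<^sup>2 = (norm (A ?u + \<beta> *\<^sub>R ?u))\<^sup>2" by simp
      also have "\<dots> = (norm (A ?u))\<^sup>2 + (\<beta> * norm ?u)\<^sup>2 + 2 * \<beta> * Re (cinner ?u (A ?u))"
        using \<open>0 \<le> \<beta>\<close> by (simp add: norm_add_sq cinner.scaleR_right positive_op_symmetric[OF pos])
      finally have "(\<beta> * norm ?u)\<^sup>2 \<le> (norm (D x))\<^sup>2"
        using pos \<open>0 \<le> \<beta>\<close> by (simp add: positive_op_def)
      then have "\<beta> * norm ?u \<le> norm (D x)" by (rule power2_le_imp_le) simp
      then have "\<beta> * norm ?u \<le> \<beta> * (e * norm x)" using Dx unfolding \<delta>_def by (simp only: mult_ac)
      then show ?thesis using \<open>0 < \<beta>\<close> by simp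
    qed
    moreover have "finite (F0 \<union> D ` F0)" using F1(1) F2(1) by (simp add: F0_def)
    ultimately show ?thesis by (rule that[rotated])
  qed
qed

text \<open>If \<open>K = A - \<beta>\<close> is small along an orthonormal sequence \<open>e\<close> orthogonal to \<open>F\<close>, then
  \<open>\<Sum>n. 2\<^sup>-\<^sup>n e n\<close> does not lie in \<open>range K + span F\<close>.\<close>

lemma limit_modulus_in_ess_spectrum:
  fixes A :: "'a::chilbert_space \<Rightarrow> 'a"
  assumes pos: "positive_op A" and lim: "limit_modulus A \<beta>" and "0 \<le> \<beta>"
    and inf: "infinite_dimensional TYPE('a)"
  shows "complex_of_real \<beta> \<in> ess_spectrum A"
proof (rule ccontr)
  define K where "K x = A x - complex_of_real \<beta> *\<^sub>C x" for x
  assume "\<not> ?thesis"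
  then obtain F where F: "finite F" "\<And>y. \<exists>c x. y = K x + (\<Sum>f\<in>F. c f *\<^sub>C f)"
    unfolding ess_spectrum_def fredholm_def K_def by auto
  have K_sym: "cinner (K x) y = cinner x (K y)" for x y
    by (simp add: K_def cinner.diff_left cinner.diff_right cinner_scaleC_left
        cinner_scaleC_right positive_op_symmetric[OF pos])
  \<comment> \<open>The powers of 1/4 decay faster than the coefficients \<open>(1 / 2) ^ n\<close>
    of the series \<open>y\<close> below.\<close>
  have step: "\<exists>x\<in>corth G. x \<in> corth F \<and> norm x = 1 \<and> norm (K x) \<le> (1 / 4) ^ n" if "finite G" for G n
  proof -
    obtain F' where F': "finite F'" "\<And>x. x \<in> corth F' \<Longrightarrow> norm (A x - \<beta> *\<^sub>R x) \<le> (1 / 4) ^ n * norm x"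
      by (rule limit_modulus_small_difference[OF pos lim \<open>0 \<le> \<beta>\<close>, of "(1 / 4) ^ n"]) auto
    have "finite (G \<union> (F \<union> F'))" using F(1) F'(1) \<open>finite G\<close> by simp
    then obtain x where "x \<in> corth (G \<union> (F \<union> F'))" "norm x = 1"
      by (rule corth_unit_vector[OF inf])
    then show ?thesis using F'(2)[of x] by (auto simp: corth_Un K_def scaleR_scaleC)
  qed
  obtain e where "\<forall>n. (e n \<in> corth F \<and> norm (e n) = 1 \<and> norm (K (e n)) \<le> (1 / 4) ^ n)
      \<and> (\<forall>i<n. cinner (e i) (e n) = 0 \<and> cinner (e i) (e n) = 0)"
    using orthogonal_sequence[of "\<lambda>n x. x \<in> corth F \<and> norm x = 1 \<and> norm (K x) \<le> (1 / 4) ^ n"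
        "\<lambda>x. x", OF step] by (rule exE)
  then have e: "e n \<in> corth F" "norm (e n) = 1" "norm (K (e n)) \<le> (1 / 4) ^ n"
    "i < n \<Longrightarrow> cinner (e i) (e n) = 0" for n i
    by blast+
  have orth: "cinner (e i) (e n) = 0" if "i \<noteq> n" for i n
    using that e(4)[of i n] e(4)[of n i] cinner_eq_0_commute by (metis nat_neq_iff)
  have summ: "summable (\<lambda>n. (1 / 2) ^ n *\<^sub>R e n)"
  proof (rule summable_norm_cancel)
    have "norm ((1 / 2) ^ n *\<^sub>R e n) = (1 / 2) ^ n" for n
      by (simp add: e(2))
    then show "summable (\<lambda>n. norm ((1 / 2) ^ n *\<^sub>R e n))" by (simp only: summable_geometric) simp
  qed
  define y where "y = (\<Sum>n. (1 / 2) ^ n *\<^sub>R e n)"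
  obtain c x where y: "y = K x + (\<Sum>f\<in>F. c f *\<^sub>C f)" using F(2) by blast
  \<comment> \<open>Pairing \<open>y\<close> with \<open>e n\<close> removes the part in the span of
    \<open>F\<close> and moves \<open>K\<close> onto \<open>e n\<close>. The one fixed
    \<open>x\<close> would thus have norm at least \<open>2 ^ n\<close> for every
    \<open>n\<close>.\<close>
  have le: "(1 / 2) ^ n \<le> (1 / 4) ^ n * norm x" for n
  proof -
    have "(\<lambda>i. cinner (e n) ((1 / 2) ^ i *\<^sub>R e i)) sums cinner (e n) y"
      unfolding y_def using summ by (intro bounded_linear.sums[OF cinner.bounded_linear_right] summable_sums)
    moreover have "(\<lambda>i. cinner (e n) ((1 / 2) ^ i *\<^sub>R e i)) = (\<lambda>i. if i = n then (1 / 2) ^ i else 0)"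
      using e(2) by (auto simp: fun_eq_iff orth cinner.scaleR_right cinner_self scaleR_conv_of_real)
    ultimately have "cinner (e n) y = (1 / 2) ^ n"
      using sums_unique2[OF _ sums_single[of n "\<lambda>i. (1 / 2 :: complex) ^ i"]] by simp
    moreover have "cinner (e n) y = cinner (K (e n)) x"
      unfolding y by (simp add: cinner.add_right cinner_corth_sum[OF e(1)] K_sym)
    ultimately have "(1 / 2) ^ n = cmod (cinner (K (e n)) x)"
      by (simp add: norm_power norm_divide)
    also have "\<dots> \<le> norm (K (e n)) * norm x" by (rule Cauchy_Schwarz_cinner)
    also have "\<dots> \<le> (1 / 4) ^ n * norm x" by (intro mult_right_mono e(3)) simp
    finally show ?thesis .
  qed
  obtain n where "norm x < 2 ^ n" using real_arch_pow[of 2 "norm x"] by auto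
  then have "(1 / 4) ^ n * norm x < (1 / 4) ^ n * 2 ^ n" by (intro mult_strict_left_mono) auto
  also have "\<dots> = (1 / 2) ^ n" by (simp add: power_mult_distrib[symmetric])
  finally show False using le[of n] by simp
qed

text \<open>\<open>A - z\<close> is \<open>K + d\<close> with \<open>d\<close> nonzero, and on some
  \<open>corth F\<close> the part \<open>K\<close> has at most half the size of \<open>d\<close>.
  Hence the kernel meets \<open>corth F\<close> only in 0, and equations are solvable modulo the
  span of \<open>F\<close> by a contraction.\<close>

lemma not_in_ess_spectrum_if_ne_limit_modulus:
  fixes A :: "'a::chilbert_space \<Rightarrow> 'a"
  assumes pos: "positive_op A" and lim: "limit_modulus A \<beta>" and "0 \<le> \<beta>"
    and "z \<noteq> complex_of_real \<beta>"
  shows "z \<notin> ess_spectrum A"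
proof -
  have bA: "bounded_clinear A" using pos by (simp add: positive_op_def)
  interpret A: bounded_linear A by (rule bounded_clinear_imp_bounded_linear) fact
  note AC = bounded_clinear_scaleC[OF bA]
  define d where "d = complex_of_real \<beta> - z"
  define K where "K x = A x - complex_of_real \<beta> *\<^sub>C x" for x
  have S: "A x - z *\<^sub>C x = K x + d *\<^sub>C x" for x by (simp add: K_def d_def scaleC.diff_left)
  have d: "d \<noteq> 0" "0 < cmod d" using assms(4) by (auto simp: d_def)
  obtain F where F: "finite F" "\<And>x. x \<in> corth F \<Longrightarrow> norm (A x - \<beta> *\<^sub>R x) \<le> cmod d / 2 * norm x"
    by (rule limit_modulus_small_difference[OF pos lim \<open>0 \<le> \<beta>\<close>, of "cmod d / 2"]) (use d in auto)
  have K_small: "norm (K x) \<le> cmod d / 2 * norm x" if "x \<in> corth F" for x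
    using F(2)[OF that] by (simp add: K_def scaleR_scaleC)
  have K_diff: "K x - K y = K (x - y)" for x y
    by (simp add: K_def A.diff scaleC.diff_right)
  have "bounded_clinear (\<lambda>x. A x - z *\<^sub>C x)"
    unfolding bounded_clinear_def
  proof (intro conjI allI)
    obtain B where B: "\<And>x. norm (A x) \<le> norm x * B" using A.bounded by blast
    have "norm (A x - z *\<^sub>C x) \<le> norm x * (B + cmod z)" for x
      by (rule order_trans[OF norm_triangle_ineq4]) (use B[of x] in \<open>simp add: norm_scaleC algebra_simps\<close>)
    then show "\<exists>K. \<forall>x. norm (A x - z *\<^sub>C x) \<le> norm x * K" by blast
  qed (simp_all add: A.add AC scaleC.add_right scaleC.diff_right scaleC_scaleC mult.commute)
  moreover have "cfinite_dim {x. A x - z *\<^sub>C x = 0}"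
  proof (rule cfinite_dim_if_trivial_corth[OF F(1)])
    show "csubspace {x. A x - z *\<^sub>C x = 0}"
      by (auto simp: csubspace_def A.zero A.add AC scaleC.zero_right scaleC.add_right scaleC_scaleC mult.commute)
    have "x = 0" if "K x + d *\<^sub>C x = 0" "x \<in> corth F" for x
    proof -
      have "K x = - (d *\<^sub>C x)" using that(1) by (simp add: add_eq_0_iff2)
      then have "norm (K x) = cmod d * norm x" by (simp add: norm_scaleC)
      then show ?thesis using K_small[OF that(2)] d by simp
    qed
    then show "{x. A x - z *\<^sub>C x = 0} \<inter> corth F \<subseteq> {0}" unfolding S by blast
  qed
  moreover have "\<exists>c x. y = (A x - z *\<^sub>C x) + (\<Sum>f\<in>F. c f *\<^sub>C f)" for y
  proof -
    \<comment> \<open>Coefficients are chosen separately for each \<open>u\<close>; Pythagoras shows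
      that the resulting map \<open>p\<close> into \<open>corth F\<close> is nonexpansive.\<close>
    obtain c where c: "\<And>u. u - (\<Sum>f\<in>F. c u f *\<^sub>C f) \<in> corth F"
      using corth_decomposition[OF F(1)] by metis
    define p where "p u = u - (\<Sum>f\<in>F. c u f *\<^sub>C f)" for u
    have p: "p u \<in> corth F" for u using c by (simp add: p_def)
    have p_contr: "norm (p u - p v) \<le> norm (u - v)" for u v
    proof -
      have pp: "p u - p v \<in> corth F" by (rule csubspace_diff[OF csubspace_corth p p])
      have eq: "u - v = (p u - p v) + ((\<Sum>f\<in>F. c u f *\<^sub>C f) - (\<Sum>f\<in>F. c v f *\<^sub>C f))"
        by (simp add: p_def)
      have "(norm (p u - p v))\<^sup>2 \<le> (norm (u - v))\<^sup>2"
        by (subst eq, subst norm_pythagoras) (simp_all add: cinner.diff_right cinner_corth_sum[OF pp])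
      then show ?thesis by (rule power2_le_imp_le) simp
    qed
    \<comment> \<open>A fixed point \<open>u\<close> satisfies \<open>d u = y - K (p u)\<close>.
      Replacing \<open>d u\<close> by \<open>d (p u)\<close> changes it by a combination of
      \<open>F\<close>, so \<open>p u\<close> solves the equation modulo that span.\<close>
    define \<phi> where "\<phi> u = (1 / d) *\<^sub>C (y - K (p u))" for u
    have "dist (\<phi> u) (\<phi> v) \<le> 1 / 2 * dist u v" for u v
    proof -
      have "\<phi> u - \<phi> v = (1 / d) *\<^sub>C (K (p v - p u))"
        by (simp add: \<phi>_def scaleC.diff_right K_diff[symmetric])
      then have "dist (\<phi> u) (\<phi> v) = norm (K (p v - p u)) / cmod d"
        by (simp add: dist_norm norm_scaleC norm_divide)
      also have "\<dots> \<le> (cmod d / 2 * norm (p v - p u)) / cmod d"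
        using d by (intro divide_right_mono K_small csubspace_diff[OF csubspace_corth] p) auto
      also have "\<dots> \<le> 1 / 2 * norm (v - u)" using d p_contr[of v u] by simp
      finally show ?thesis by (simp add: dist_norm norm_minus_commute)
    qed
    then obtain u where u: "\<phi> u = u"
      using banach_fix_type[of "1 / 2" \<phi>] by auto
    have "d *\<^sub>C \<phi> u = y - K (p u)" using d by (simp add: \<phi>_def scaleC_scaleC scaleC_one)
    then have "y = K (p u) + d *\<^sub>C u" using u by simp
    also have "d *\<^sub>C u = d *\<^sub>C p u + (\<Sum>f\<in>F. (d * c u f) *\<^sub>C f)"
      by (simp add: p_def scaleC.diff_right scaleC.sum_right scaleC_scaleC)
    finally have "y = (A (p u) - z *\<^sub>C p u) + (\<Sum>f\<in>F. (d * c u f) *\<^sub>C f)"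
      by (simp add: S add.assoc)
    then show ?thesis by (intro exI[of _ "\<lambda>f. d * c u f"] exI[of _ "p u"])
  qed
  ultimately have "fredholm (\<lambda>x. A x - z *\<^sub>C x)" unfolding fredholm_def using F(1) by blast
  then show ?thesis by (simp add: ess_spectrum_def)
qed

section \<open>Block operators with off-diagonal entries of finite rank\<close>

lemma corth_prod: "corth ((\<lambda>f. (f, 0)) ` F \<union> Pair 0 ` G) = corth F \<times> corth G"
  by (auto simp: corth_def cinner_prod_def cinner.zero_left ball_Un)

text \<open>Let the span of \<open>F\<close> contain the range of \<open>X\<close>. The adjoint
  vanishes on \<open>corth F\<close>; and if \<open>y\<close> is orthogonal to the images of
  \<open>F\<close> under the adjoint, \<open>X y\<close> lies both in that span and in
  \<open>corth F\<close>, hence is 0.\<close>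

lemma block_op_finite_rank_diagonal:
  fixes X :: "'b::complex_inner \<Rightarrow> 'a::complex_inner"
  assumes pos: "positive_op (block_op A1 X A2)" and "bounded_clinear X" "finite_rank X"
    and "bounded_clinear A1" "bounded_clinear A2"
  obtains F G where "finite F" "finite G"
    "\<And>x y. x \<in> corth F \<Longrightarrow> y \<in> corth G \<Longrightarrow> block_op A1 X A2 (x, y) = (A1 x, A2 y)"
proof -
  interpret X: bounded_linear X by (rule bounded_clinear_imp_bounded_linear) fact
  interpret A1: bounded_linear A1 by (rule bounded_clinear_imp_bounded_linear) fact
  interpret A2: bounded_linear A2 by (rule bounded_clinear_imp_bounded_linear) fact
  \<comment> \<open>\<open>cadjoint\<close> is a definite description; its defining relation is read
    off from the symmetry of the positive block operator at \<open>(x, 0)\<close> and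
    \<open>(0, y)\<close>.\<close>
  have adj: "cinner (cadjoint X x) y = cinner x (X y)" for x y
    using positive_op_symmetric[OF pos, of "(x, 0)" "(0, y)"]
    by (simp add: block_op_def cinner_prod_def X.zero A1.zero A2.zero cinner.zero_left cinner.zero_right)
  obtain F where F: "finite F" "\<And>y. \<exists>c. X y = (\<Sum>f\<in>F. c f *\<^sub>C f)"
    using \<open>finite_rank X\<close> unfolding finite_rank_def cfinite_dim_def by auto
  have "cadjoint X x = 0" if "x \<in> corth F" for x
  proof -
    have "cinner x (X y) = 0" for y using F(2)[of y] cinner_corth_sum[OF that] by auto
    then show ?thesis using adj[of x "cadjoint X x"] by (simp add: cinner_eq_zero_iff)
  qed
  moreover have "X y = 0" if "y \<in> corth (cadjoint X ` F)" for y
  proof -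
    have "X y \<in> corth F" using that by (simp add: corth_def adj)
    then have "cinner (X y) (X y) = 0" using F(2)[of y] cinner_corth_sum by metis
    then show ?thesis by (simp add: cinner_eq_zero_iff)
  qed
  ultimately have "block_op A1 X A2 (x, y) = (A1 x, A2 y)"
    if "x \<in> corth F" "y \<in> corth (cadjoint X ` F)" for x y
    using that by (simp add: block_op_def)
  then show ?thesis using that F(1) by blast
qed

lemma block_op_limit_modulus:
  fixes X :: "'b::complex_inner \<Rightarrow> 'a::complex_inner"
  assumes "positive_op (block_op A1 X A2)" "bounded_clinear X" "finite_rank X"
    and "bounded_clinear A1" "bounded_clinear A2"
    and lim: "limit_modulus A1 \<beta>" "limit_modulus A2 \<beta>" and "0 \<le> \<beta>"
  shows "limit_modulus (block_op A1 X A2) \<beta>"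
proof -
  obtain F G where FG: "finite F" "finite G"
    "\<And>x y. x \<in> corth F \<Longrightarrow> y \<in> corth G \<Longrightarrow> block_op A1 X A2 (x, y) = (A1 x, A2 y)"
    using block_op_finite_rank_diagonal[OF assms(1-5)] by blast
  \<comment> \<open>Componentwise estimates on \<open>corth F'\<close> and \<open>corth G'\<close>
    combine into one on pairs, after adding \<open>F\<close> and \<open>G\<close> to make the block
    operator diagonal.\<close>
  have ex: "\<exists>H. finite H \<and> (\<forall>z\<in>corth H. P z)"
    if "finite F'" "finite G'"
      "\<And>x y. x \<in> corth F' \<Longrightarrow> y \<in> corth G' \<Longrightarrow> x \<in> corth F \<Longrightarrow> y \<in> corth G \<Longrightarrow> P (x, y)"
    for F' G' P
  proof (intro exI conjI ballI)
    let ?H = "(\<lambda>f. (f, 0)) ` (F' \<union> F) \<union> Pair 0 ` (G' \<union> G)"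
    show "finite ?H" using that(1,2) FG(1,2) by simp
    fix z assume "z \<in> corth ?H"
    then have "z \<in> corth (F' \<union> F) \<times> corth (G' \<union> G)" by (simp only: corth_prod)
    then show "P z" using that(3) by (auto simp: corth_Un)
  qed
  have norm_pair: "(norm (x, y))\<^sup>2 = (norm x)\<^sup>2 + (norm y)\<^sup>2" for x :: 'a and y :: 'b
    by (simp add: norm_Pair)
  show ?thesis
    unfolding limit_modulus_def
  proof (intro conjI allI impI)
    fix e :: real assume "e > 0"
    obtain F' where F': "finite F'" "\<And>x. x \<in> corth F' \<Longrightarrow> (\<beta> - e) * norm x \<le> norm (A1 x)"
      using lim(1) \<open>e > 0\<close> unfolding limit_modulus_def by blast
    obtain G' where G': "finite G'" "\<And>x. x \<in> corth G' \<Longrightarrow> (\<beta> - e) * norm x \<le> norm (A2 x)"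
      using lim(2) \<open>e > 0\<close> unfolding limit_modulus_def by blast
    show "\<exists>H. finite H \<and> (\<forall>z\<in>corth H. (\<beta> - e) * norm z \<le> norm (block_op A1 X A2 z))"
    proof (rule ex[OF F'(1) G'(1)])
      fix x y assume xy: "x \<in> corth F'" "y \<in> corth G'" "x \<in> corth F" "y \<in> corth G"
      show "(\<beta> - e) * norm (x, y) \<le> norm (block_op A1 X A2 (x, y))"
      proof (cases "0 \<le> \<beta> - e")
        case True
        have "((\<beta> - e) * norm (x, y))\<^sup>2 = ((\<beta> - e) * norm x)\<^sup>2 + ((\<beta> - e) * norm y)\<^sup>2"
          by (simp only: power_mult_distrib norm_pair distrib_left)
        also have "\<dots> \<le> (norm (A1 x))\<^sup>2 + (norm (A2 y))\<^sup>2"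
          using True F'(2)[OF xy(1)] G'(2)[OF xy(2)] by (intro add_mono power_mono) auto
        also have "\<dots> = (norm (block_op A1 X A2 (x, y)))\<^sup>2"
          by (simp only: FG(3)[OF xy(3,4)] norm_pair)
        finally show ?thesis by (rule power2_le_imp_le) simp
      next
        case False
        then show ?thesis by (meson mult_nonpos_nonneg norm_ge_zero not_le_imp_less less_imp_le order_trans)
      qed
    qed
  next
    obtain F' where F': "finite F'" "\<And>x. x \<in> corth F' \<Longrightarrow> norm (A1 x) \<le> \<beta> * norm x"
      using lim(1) unfolding limit_modulus_def by blast
    obtain G' where G': "finite G'" "\<And>x. x \<in> corth G' \<Longrightarrow> norm (A2 x) \<le> \<beta> * norm x"
      using lim(2) unfolding limit_modulus_def by blast
    show "\<exists>H. finite H \<and> (\<forall>z\<in>corth H. norm (block_op A1 X A2 z) \<le> \<beta> * norm z)"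
    proof (rule ex[OF F'(1) G'(1)])
      fix x y assume xy: "x \<in> corth F'" "y \<in> corth G'" "x \<in> corth F" "y \<in> corth G"
      have "(norm (block_op A1 X A2 (x, y)))\<^sup>2 = (norm (A1 x))\<^sup>2 + (norm (A2 y))\<^sup>2"
        by (simp only: FG(3)[OF xy(3,4)] norm_pair)
      also have "\<dots> \<le> (\<beta> * norm x)\<^sup>2 + (\<beta> * norm y)\<^sup>2"
        using F'(2)[OF xy(1)] G'(2)[OF xy(2)] by (intro add_mono power_mono) auto
      also have "\<dots> = (\<beta> * norm (x, y))\<^sup>2"
        by (simp only: power_mult_distrib norm_pair distrib_left)
      finally show "norm (block_op A1 X A2 (x, y)) \<le> \<beta> * norm (x, y)"
        by (rule power2_le_imp_le) (use \<open>0 \<le> \<beta>\<close> in simp)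
    qed
  qed
qed

theorem theorem4p7:
  fixes A1 :: "'a::chilbert_space \<Rightarrow> 'a"
    and A2 :: "'b::chilbert_space \<Rightarrow> 'b"
    and X :: "'b \<Rightarrow> 'a"
  assumes "separable_metric TYPE('a)" and "infinite_dimensional TYPE('a)"
    and "separable_metric TYPE('b)" and "infinite_dimensional TYPE('b)"
    and "positive_op A1" and "positive_op A2"
    and "bounded_clinear X"
    and "positive_op (block_op A1 X A2)"
    and "abs_min_attaining A1" and "abs_min_attaining A2"
    and "ess_spectrum A1 = ess_spectrum A2"
    and "finite_rank X"
  shows "abs_min_attaining (block_op A1 X A2)"
proof -
  obtain \<beta>1 where \<beta>1: "0 \<le> \<beta>1" "limit_modulus A1 \<beta>1"
    using abs_min_attaining_limit_modulus assms(2,5,9) by blast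
  obtain \<beta>2 where \<beta>2: "0 \<le> \<beta>2" "limit_modulus A2 \<beta>2"
    using abs_min_attaining_limit_modulus assms(4,6,10) by blast
  \<comment> \<open>The essential spectrum of \<open>A1\<close> contains \<open>\<beta>1\<close>,
    while that of \<open>A2\<close> contains nothing but \<open>\<beta>2\<close>.\<close>
  have "complex_of_real \<beta>1 \<in> ess_spectrum A2"
    using limit_modulus_in_ess_spectrum[OF assms(5) \<beta>1(2,1) assms(2)] assms(11) by simp
  then have "\<beta>1 = \<beta>2"
    using not_in_ess_spectrum_if_ne_limit_modulus[OF assms(6) \<beta>2(2,1)] of_real_eq_iff by blast
  then have "limit_modulus (block_op A1 X A2) \<beta>1"
    using assms(5,6) \<beta>1 \<beta>2
    by (intro block_op_limit_modulus assms(7,8,12)) (auto simp: positive_op_def)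
  moreover have "bounded_clinear (block_op A1 X A2)"
    using assms(8) by (simp add: positive_op_def)
  ultimately show ?thesis by (intro abs_min_attaining_if_limit_modulus)
qed

end
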